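(* Let $\mathcal A^*=\bigoplus_{j=0}^n\mathcal A^{2j}$ be a Poincaré duality algebra over $\mathbb R$ of formal dimension $2n$ which is generated (as an algebra) by its degree-$2$ component $\mathcal A^2$. Then there exists a complete simplicial multi-fan $\Delta$ (in some $n$-dimensional oriented Euclidean space, on some finite vertex set) such that $\mathcal A^*\cong\mathcal A^*(\Delta)$ as graded algebras.
   Context: A Poincaré duality algebra of formal dimension $2n$ over $\mathbb R$ is a finite-dimensional graded commutative $\mathbb R$-algebra $\mathcal A^*=\bigoplus_{j=0}^n\mathcal A^{2j}$ together with an isomorphism $\int\colon\mathcal A^{2n}\to\mathbb R$ such that the pairings $\mathcal A^{2p}\otimes\mathcal A^{2n-2p}\to\mathbb R$, $a\otimes b\mapsto\int ab$, are non-degenerate. Multi-fans. Let $V$ be an oriented real vector space of dimension $n\ge1$ with an inner product; identify $V^*$ with $V$. For a set $I$ with $\{\lambda(i)\}_{i\in I}$ a basis of $V$, let $|\det\lambda_I|$ be the volume of the parallelepiped spanned by these vectors. A complete simplicial multi-fan $\Delta=(w,\lambda)$ in $V$ on the vertex set $[m]=\{1,\dots,m\}$ is a pair consisting of a function $w\colon\binom{[m]}{n}\to\mathbb R$ (weights of $n$-element subsets) and a map $\lambda\colon[m]\to V$ such that (i) whenever $w(I)\ne0$, $\{\lambda(i)\}_{i\in I}$ is a basis of $V$; (ii) orienting each such $I$ by declaring an ordering $(i_1,\dots,i_n)$ positive iff $(\lambda(i_1),\dots,\lambda(i_n))$ is a positive basis of $V$, the real simplicial chain $w_{ch}=\sum_I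 w(I)I$ is a cycle in the chain complex of the $(n-1)$-skeleton of the full simplex on $[m]$ (for $n=1$ the boundary of $0$-chains is the augmentation). Volume polynomial and algebra. Grade $\mathbb R[x_1,\dots,x_m]$ by $\deg x_i=2$. For $I$ with $w(I)\ne0$ let $\{u^I_i\}_{i\in I}\subset V^*$ be the basis dual to $\{\lambda(i)\}_{i\in I}$ and $\iota_I\colon\mathbb R[x_1,\dots,x_m]\to\mathbb R[V^*]$ the algebra homomorphism with $\iota_I(x_i)=u^I_i$ for $i\in I$ and $\iota_I(x_i)=0$ otherwise. For homogeneous $x$ of degree $2n$ the rational function $\int_\Delta x:=\sum_{I:\,w(I)\ne0}\frac{w(I)\iota_I(x)}{|\det\lambda_I|\prod_{i\in I}\iota_I(x_i)}$ is a real constant. The volume polynomial is $V_\Delta(c_1,\dots,c_m)=\frac1{n!}\int_\Delta(c_1x_1+\dots+c_mx_m)^n$. Let $\mathcal D=\mathbb R[\partial_1,\dots,\partial_m]$, $\partial_i=\partial/\partial c_i$, graded by $\deg\partial_i=2$. The multi-fan algebra is $\mathcal A^*(\Delta)=\mathcal D/\mathrm{Ann}(V_\Delta)$, where $\mathrm{Ann}(V_\Delta)=\{D\in\mathcal D: DV_\Delta=0\}$. *)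

theory Defs
  imports
    "HOL-Library.Poly_Mapping"
    "HOL-Computational_Algebra.Fraction_Field"
    "HOL-Algebra.QuotRing"
    "Jordan_Normal_Form.Determinant"
    "Jordan_Normal_Form.VS_Connect"
    HOL.Hull
begin

section \<open>Poincare duality algebras\<close>

text \<open>All degrees are even and are halved throughout: \<open>A j\<close> is the component of degree \<open>2j\<close>,
  and \<open>n\<close> stands for formal dimension \<open>2n\<close>. The ambient algebra is the whole type. Only the
  restriction of \<open>intg\<close> to \<open>A n\<close> matters.\<close>

locale poincare_duality_algebra =
  fixes n :: nat
    and A :: "nat \<Rightarrow> 'a::{comm_ring_1,real_algebra_1} set"
    and intg :: "'a \<Rightarrow> real"
  assumes finite_dim: "\<exists>B :: 'a set. finite B \<and> real_vector.span B = UNIV"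
    and component_subspace: "\<And>j. real_vector.subspace (A j)"
    and component_trivial: "\<And>j. j > n \<Longrightarrow> A j = {0}"
    and direct_sum: "\<And>a. \<exists>!f. (\<forall>j. f j \<in> A j) \<and> a = (\<Sum>j\<le>n. f j)"
    and one_component: "1 \<in> A 0"
    and mult_component: "\<And>i j a b. a \<in> A i \<Longrightarrow> b \<in> A j \<Longrightarrow> a * b \<in> A (i + j)"
    and intg_add: "\<And>a b. a \<in> A n \<Longrightarrow> b \<in> A n \<Longrightarrow> intg (a + b) = intg a + intg b"
    and intg_scale: "\<And>r a. a \<in> A n \<Longrightarrow> intg (r *\<^sub>R a) = r * intg a"
    and intg_bij: "bij_betw intg (A n) UNIV"
    and nondegenerate_left:
      "\<And>p a. p \<le> n \<Longrightarrow> a \<in> A p \<Longrightarrow> (\<And>b. b \<in> A (n - p) \<Longrightarrow> intg (a * b) = 0) \<Longrightarrow> a = 0"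
    and nondegenerate_right:
      "\<And>p b. p \<le> n \<Longrightarrow> b \<in> A (n - p) \<Longrightarrow> (\<And>a. a \<in> A p \<Longrightarrow> intg (a * b) = 0) \<Longrightarrow> b = 0"

definition unital_subalgebra :: "'a::{comm_ring_1,real_algebra_1} set \<Rightarrow> bool" where
  "unital_subalgebra S \<longleftrightarrow>
     real_vector.subspace S \<and> 1 \<in> S \<and> (\<forall>a\<in>S. \<forall>b\<in>S. a * b \<in> S)"

definition generated_in_degree_two :: "(nat \<Rightarrow> 'a::{comm_ring_1,real_algebra_1} set) \<Rightarrow> bool" where
  "generated_in_degree_two A \<longleftrightarrow> unital_subalgebra hull (A 1) = UNIV"


section \<open>Real polynomials in several variables\<close>

text \<open>Polynomials in variables indexed by natural numbers, as finitely supported functions on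
  exponent vectors, with the convolution product of \<open>Poly_Mapping\<close>.\<close>

type_synonym mpoly = "(nat \<Rightarrow>\<^sub>0 nat) \<Rightarrow>\<^sub>0 real"

definition mconst :: "real \<Rightarrow> mpoly" where
  "mconst r = Poly_Mapping.single 0 r"

definition mvar :: "nat \<Rightarrow> mpoly" where
  "mvar i = Poly_Mapping.single (Poly_Mapping.single i 1) 1"

definition mpolys_in :: "nat set \<Rightarrow> mpoly set" where
  "mpolys_in S = {p. \<forall>\<alpha> \<in> Poly_Mapping.keys p. Poly_Mapping.keys \<alpha> \<subseteq> S}"

definition homogeneous :: "nat \<Rightarrow> mpoly \<Rightarrow> bool" where
  "homogeneous d p \<longleftrightarrow>
     (\<forall>\<alpha> \<in> Poly_Mapping.keys p. (\<Sum>i \<in> Poly_Mapping.keys \<alpha>. Poly_Mapping.lookup \<alpha> i) = d)"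

text \<open>The homomorphism \<open>mvar i \<mapsto> f i\<close> that acts on coefficients by \<open>e\<close>.\<close>

definition msubst :: "(real \<Rightarrow> 'b::comm_ring_1) \<Rightarrow> (nat \<Rightarrow> 'b) \<Rightarrow> mpoly \<Rightarrow> 'b" where
  "msubst e f p = (\<Sum>\<alpha> \<in> Poly_Mapping.keys p. e (Poly_Mapping.lookup p \<alpha>) *
     (\<Prod>i \<in> Poly_Mapping.keys \<alpha>. f i ^ Poly_Mapping.lookup \<alpha> i))"

definition mpderiv :: "nat \<Rightarrow> mpoly \<Rightarrow> mpoly" where
  "mpderiv i p = (\<Sum>\<alpha> \<in> Poly_Mapping.keys p.
     Poly_Mapping.single (\<alpha> - Poly_Mapping.single i 1)
       (of_nat (Poly_Mapping.lookup \<alpha> i) * Poly_Mapping.lookup p \<alpha>))"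

text \<open>An element of \<open>\<D>\<close> is stored as a polynomial in which \<open>mvar i\<close> stands for
  \<open>\<partial>\<^sub>i\<close>; \<open>apply_diff D p\<close> is \<open>D p\<close>.\<close>

definition mpderiv_multi :: "(nat \<Rightarrow>\<^sub>0 nat) \<Rightarrow> mpoly \<Rightarrow> mpoly" where
  "mpderiv_multi \<alpha> =
     foldr (\<lambda>i. mpderiv i ^^ Poly_Mapping.lookup \<alpha> i) (sorted_list_of_set (Poly_Mapping.keys \<alpha>))"

definition apply_diff :: "mpoly \<Rightarrow> mpoly \<Rightarrow> mpoly" where
  "apply_diff D p = (\<Sum>\<alpha> \<in> Poly_Mapping.keys D.
     mconst (Poly_Mapping.lookup D \<alpha>) * mpderiv_multi \<alpha> p)"


section \<open>Complete simplicial multi-fans\<close>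

text \<open>The oriented Euclidean space is \<open>V = \<real>\<^sup>n\<close>, i.e. \<open>carrier_vec n\<close> with its standard
  scalar product and orientation. A multi-fan on \<open>{1..m}\<close> is given by \<open>w\<close>, of which only the
  values on \<open>n\<close>-element subsets of \<open>{1..m}\<close> matter, and \<open>lam\<close>, of which only the values on
  \<open>{1..m}\<close> matter.\<close>

definition fan_cones :: "nat \<Rightarrow> nat \<Rightarrow> (nat set \<Rightarrow> real) \<Rightarrow> nat set set" where
  "fan_cones n m w = {I. I \<subseteq> {1..m} \<and> card I = n \<and> w I \<noteq> 0}"

text \<open>The determinant of the vectors \<open>lam i\<close>, \<open>i \<in> I\<close>, in increasing order of \<open>i\<close>. Its absolute
  value is the volume of the parallelepiped, its sign tells whether the increasing ordering of
  \<open>I\<close> is positive.\<close>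

definition fan_det :: "nat \<Rightarrow> (nat \<Rightarrow> real vec) \<Rightarrow> nat set \<Rightarrow> real" where
  "fan_det n lam I = det (mat_of_cols n (map lam (sorted_list_of_set I)))"

text \<open>Simplicial chains are written with respect to the increasing orientation of each simplex, so
  the oriented simplex \<open>I\<close> of the multi-fan contributes with the sign of \<open>fan_det\<close>.\<close>

definition fan_chain :: "nat \<Rightarrow> (nat set \<Rightarrow> real) \<Rightarrow> (nat \<Rightarrow> real vec) \<Rightarrow> nat set \<Rightarrow> real" where
  "fan_chain n w lam I = sgn (fan_det n lam I) * w I"

text \<open>The coefficient at \<open>J\<close> of the simplicial boundary: the face \<open>J\<close> of \<open>insert v J\<close> arises by
  deleting the vertex \<open>v\<close>, which has \<open>card {j \<in> J. j < v}\<close> predecessors. For \<open>J = {}\<close> this is the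
  augmentation of a \<open>0\<close>-chain.\<close>

definition chain_boundary :: "nat \<Rightarrow> (nat set \<Rightarrow> real) \<Rightarrow> nat set \<Rightarrow> real" where
  "chain_boundary m c J = (\<Sum>v \<in> {1..m} - J. (-1) ^ card {j \<in> J. j < v} * c (insert v J))"

definition complete_multi_fan ::
  "nat \<Rightarrow> nat \<Rightarrow> (nat set \<Rightarrow> real) \<Rightarrow> (nat \<Rightarrow> real vec) \<Rightarrow> bool" where
  "complete_multi_fan n m w lam \<longleftrightarrow>
     n \<ge> 1 \<and>
     (\<forall>i \<in> {1..m}. lam i \<in> carrier_vec n) \<and>
     (\<forall>I \<in> fan_cones n m w.
        inj_on lam I \<and> vectorspace.basis class_ring (module_vec TYPE(real) n) (lam ` I)) \<and>
     (\<forall>J. J \<subseteq> {1..m} \<and> card J = n - 1 \<longrightarrow> chain_boundary m (fan_chain n w lam) J = 0)"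


section \<open>Volume polynomial and multi-fan algebra\<close>

text \<open>The dual basis vector \<open>u\<^sup>I\<^sub>i\<close>, with \<open>V\<^sup>*\<close> identified with \<open>V\<close> by the scalar product.\<close>

definition dual_vec :: "nat \<Rightarrow> (nat \<Rightarrow> real vec) \<Rightarrow> nat set \<Rightarrow> nat \<Rightarrow> real vec" where
  "dual_vec n lam I i =
     (THE u. u \<in> carrier_vec n \<and> (\<forall>j \<in> I. u \<bullet> lam j = (if j = i then 1 else 0)))"

text \<open>\<open>\<real>[V\<^sup>*]\<close> is the polynomial ring in the \<open>n\<close> coordinate functions of \<open>V\<close>, which
  are \<open>mvar 0, \<dots>, mvar (n - 1)\<close>.\<close>

definition linear_form :: "nat \<Rightarrow> real vec \<Rightarrow> mpoly" where
  "linear_form n u = (\<Sum>k<n. mconst (u $ k) * mvar k)"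

definition fan_iota :: "nat \<Rightarrow> (nat \<Rightarrow> real vec) \<Rightarrow> nat set \<Rightarrow> mpoly \<Rightarrow> mpoly" where
  "fan_iota n lam I =
     msubst mconst (\<lambda>i. if i \<in> I then linear_form n (dual_vec n lam I i) else 0)"

text \<open>Meaningful for homogeneous \<open>x\<close> of polynomial degree \<open>n\<close>, when the rational function
  is constant.\<close>

definition fan_integral ::
  "nat \<Rightarrow> nat \<Rightarrow> (nat set \<Rightarrow> real) \<Rightarrow> (nat \<Rightarrow> real vec) \<Rightarrow> mpoly \<Rightarrow> real" where
  "fan_integral n m w lam x = (THE r.
     (\<Sum>I \<in> fan_cones n m w.
        Fraction_Field.Fract (mconst (w I) * fan_iota n lam I x)
          (mconst \<bar>fan_det n lam I\<bar> * (\<Prod>i\<in>I. fan_iota n lam I (mvar i))))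
     = Fraction_Field.Fract (mconst r) 1)"

text \<open>The polynomial in \<open>c\<^sub>1, \<dots>, c\<^sub>m\<close> (here \<open>mvar 1, \<dots>, mvar m\<close>) with the prescribed values.\<close>

definition volume_polynomial ::
  "nat \<Rightarrow> nat \<Rightarrow> (nat set \<Rightarrow> real) \<Rightarrow> (nat \<Rightarrow> real vec) \<Rightarrow> mpoly" where
  "volume_polynomial n m w lam = (THE P. P \<in> mpolys_in {1..m} \<and>
     (\<forall>c :: nat \<Rightarrow> real. msubst (\<lambda>r. r) c P =
        1 / fact n * fan_integral n m w lam ((\<Sum>i=1..m. mconst (c i) * mvar i) ^ n)))"

definition diff_ops :: "nat \<Rightarrow> mpoly ring" where
  "diff_ops m = \<lparr>carrier = mpolys_in {1..m}, mult = (*), one = 1, zero = 0, add = (+)\<rparr>"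

definition annihilator :: "nat \<Rightarrow> mpoly \<Rightarrow> mpoly set" where
  "annihilator m P = {D \<in> carrier (diff_ops m). apply_diff D P = 0}"

definition multi_fan_algebra ::
  "nat \<Rightarrow> nat \<Rightarrow> (nat set \<Rightarrow> real) \<Rightarrow> (nat \<Rightarrow> real vec) \<Rightarrow> mpoly set ring" where
  "multi_fan_algebra n m w lam =
     diff_ops m Quot annihilator m (volume_polynomial n m w lam)"

definition multi_fan_class ::
  "nat \<Rightarrow> nat \<Rightarrow> (nat set \<Rightarrow> real) \<Rightarrow> (nat \<Rightarrow> real vec) \<Rightarrow> mpoly \<Rightarrow> mpoly set" where
  "multi_fan_class n m w lam D =
     annihilator m (volume_polynomial n m w lam) +>\<^bsub>diff_ops m\<^esub> D"

text \<open>The component of degree \<open>2j\<close>.\<close>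

definition multi_fan_component ::
  "nat \<Rightarrow> nat \<Rightarrow> (nat set \<Rightarrow> real) \<Rightarrow> (nat \<Rightarrow> real vec) \<Rightarrow> nat \<Rightarrow> mpoly set set" where
  "multi_fan_component n m w lam j =
     multi_fan_class n m w lam ` {D \<in> carrier (diff_ops m). homogeneous j D}"

text \<open>Scalars act on the quotient through the classes of the constants.\<close>

definition graded_isomorphic_to_multi_fan_algebra ::
  "(nat \<Rightarrow> 'a::{comm_ring_1,real_algebra_1} set) \<Rightarrow>
     nat \<Rightarrow> nat \<Rightarrow> (nat set \<Rightarrow> real) \<Rightarrow> (nat \<Rightarrow> real vec) \<Rightarrow> bool" where
  "graded_isomorphic_to_multi_fan_algebra A n m w lam \<longleftrightarrow>
     (\<exists>\<phi> \<in> ring_iso (class_ring :: 'a ring) (multi_fan_algebra n m w lam).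
        (\<forall>r a. \<phi> (r *\<^sub>R a) =
           multi_fan_class n m w lam (mconst r) \<otimes>\<^bsub>multi_fan_algebra n m w lam\<^esub> \<phi> a) \<and>
        (\<forall>j. \<phi> ` A j = multi_fan_component n m w lam j))"

end

theory Submission
  imports Defs "HOL-Computational_Algebra.Polynomial_Factorial"
begin

text \<open>Fix vectors \<open>lam 1, \<dots>, lam m\<close> on the moment curve, so that any \<open>n\<close> of them form a basis. A
  functional \<open>L\<close> on monomials of degree \<open>n\<close> that kills the multiples of all linear forms
  \<open>\<Sum>\<^sub>i \<langle>v, lam i\<rangle> x\<^sub>i\<close> is the integral of a multi-fan: the only possible weights are
  \<open>w I = \<bar>det lam\<^sub>I\<bar> L x\<^sub>I\<close>, the linear relations of \<open>L\<close> turn into the cycle condition by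
  Laplace expansion, and, as \<open>lam\<close> is generic, they express every monomial through square-free ones.
  For a Poincare duality algebra choose \<open>x\<^sub>1, \<dots>, x\<^sub>m\<close> spanning its degree-2 part and satisfying
  \<open>\<Sum>\<^sub>i \<langle>v, lam i\<rangle> x\<^sub>i = 0\<close> for all \<open>v\<close>, which costs \<open>n\<close> additional elements, and let \<open>L\<close> be the integral
  of the algebra. Then \<open>\<partial>\<^sub>i \<mapsto> x\<^sub>i\<close> is surjective, and by Poincare duality its kernel is the
  annihilator of the volume polynomial.\<close>


section \<open>Monomials and substitution\<close>

definition mdeg :: "(nat \<Rightarrow>\<^sub>0 nat) \<Rightarrow> nat" where
  "mdeg \<alpha> = (\<Sum>i \<in> Poly_Mapping.keys \<alpha>. Poly_Mapping.lookup \<alpha> i)"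

definition mpow :: "(nat \<Rightarrow> 'b::comm_ring_1) \<Rightarrow> (nat \<Rightarrow>\<^sub>0 nat) \<Rightarrow> 'b" where
  "mpow f \<alpha> = (\<Prod>i \<in> Poly_Mapping.keys \<alpha>. f i ^ Poly_Mapping.lookup \<alpha> i)"

definition mfact :: "(nat \<Rightarrow>\<^sub>0 nat) \<Rightarrow> real" where
  "mfact \<alpha> = (\<Prod>i \<in> Poly_Mapping.keys \<alpha>. fact (Poly_Mapping.lookup \<alpha> i))"

lemma keys_add_nat:
  "Poly_Mapping.keys (\<alpha> + \<beta> :: nat \<Rightarrow>\<^sub>0 nat) = Poly_Mapping.keys \<alpha> \<union> Poly_Mapping.keys \<beta>"
  by (auto simp: in_keys_iff lookup_add)

lemma mdeg_eq_sum:
  assumes "finite S" "Poly_Mapping.keys \<alpha> \<subseteq> S"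
  shows "mdeg \<alpha> = (\<Sum>i\<in>S. Poly_Mapping.lookup \<alpha> i)"
  unfolding mdeg_def using assms by (intro sum.mono_neutral_left) (auto simp: in_keys_iff)

lemma mpow_eq_prod:
  assumes "finite S" "Poly_Mapping.keys \<alpha> \<subseteq> S"
  shows "mpow f \<alpha> = (\<Prod>i\<in>S. f i ^ Poly_Mapping.lookup \<alpha> i)"
  unfolding mpow_def using assms by (intro prod.mono_neutral_left) (auto simp: in_keys_iff)

lemma mfact_eq_prod:
  assumes "finite S" "Poly_Mapping.keys \<alpha> \<subseteq> S"
  shows "mfact \<alpha> = (\<Prod>i\<in>S. fact (Poly_Mapping.lookup \<alpha> i))"
  unfolding mfact_def using assms by (intro prod.mono_neutral_left) (auto simp: in_keys_iff)

lemma mdeg_add: "mdeg (\<alpha> + \<beta>) = mdeg \<alpha> + mdeg \<beta>"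
proof -
  let ?S = "Poly_Mapping.keys \<alpha> \<union> Poly_Mapping.keys \<beta>"
  show ?thesis
    by (simp add: mdeg_eq_sum[of ?S] keys_add_nat lookup_add sum.distrib)
qed

lemma mpow_add: "mpow f (\<alpha> + \<beta>) = mpow f \<alpha> * mpow f \<beta>"
proof -
  let ?S = "Poly_Mapping.keys \<alpha> \<union> Poly_Mapping.keys \<beta>"
  show ?thesis
    by (simp add: mpow_eq_prod[of ?S] keys_add_nat lookup_add power_add prod.distrib)
qed

lemma mdeg_0 [simp]: "mdeg 0 = 0"
  by (simp add: mdeg_def)

lemma mpow_0 [simp]: "mpow f 0 = 1"
  by (simp add: mpow_def)

lemma mdeg_single [simp]: "mdeg (Poly_Mapping.single i k) = k"
  by (simp add: mdeg_def)

lemma mpow_single [simp]: "mpow f (Poly_Mapping.single i k) = f i ^ k"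
  by (simp add: mpow_def)

lemma mfact_nonzero [simp]: "mfact \<alpha> \<noteq> 0"
  by (simp add: mfact_def)

lemma mfact_add_single:
  "mfact (\<alpha> + Poly_Mapping.single i 1) = (real (Poly_Mapping.lookup \<alpha> i) + 1) * mfact \<alpha>"
proof -
  let ?S = "insert i (Poly_Mapping.keys \<alpha>)"
  have "mfact (\<alpha> + Poly_Mapping.single i 1) =
      (\<Prod>j\<in>?S. fact (Poly_Mapping.lookup (\<alpha> + Poly_Mapping.single i 1) j))"
    by (rule mfact_eq_prod) (simp, simp add: keys_add_nat subset_insertI)
  also have "\<dots> = fact (Suc (Poly_Mapping.lookup \<alpha> i)) *
      (\<Prod>j\<in>?S - {i}. fact (Poly_Mapping.lookup (\<alpha> + Poly_Mapping.single i 1) j))"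
    by (subst prod.remove[of _ i]) (auto simp: lookup_add)
  also have "(\<Prod>j\<in>?S - {i}. fact (Poly_Mapping.lookup (\<alpha> + Poly_Mapping.single i 1) j)) =
      (\<Prod>j\<in>?S - {i}. fact (Poly_Mapping.lookup \<alpha> j) :: real)"
    by (intro prod.cong) (auto simp: lookup_add lookup_single)
  also have "fact (Suc (Poly_Mapping.lookup \<alpha> i)) * \<dots> =
     (real (Poly_Mapping.lookup \<alpha> i) + 1) *
     (fact (Poly_Mapping.lookup \<alpha> i) * (\<Prod>j\<in>?S - {i}. fact (Poly_Mapping.lookup \<alpha> j)))"
    by (simp add: algebra_simps)
  also have "fact (Poly_Mapping.lookup \<alpha> i) * (\<Prod>j\<in>?S - {i}. fact (Poly_Mapping.lookup \<alpha> j)) =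
      mfact \<alpha>"
    by (subst mfact_eq_prod[of ?S], simp, blast, subst prod.remove[of _ i]) auto
  finally show ?thesis .
qed

lemma card_keys_le_mdeg: "card (Poly_Mapping.keys \<alpha>) \<le> mdeg \<alpha>"
proof -
  have "card (Poly_Mapping.keys \<alpha>) = (\<Sum>i\<in>Poly_Mapping.keys \<alpha>. 1)" by simp
  also have "\<dots> \<le> mdeg \<alpha>"
    unfolding mdeg_def by (intro sum_mono) (simp add: in_keys_iff Suc_leI)
  finally show ?thesis .
qed

lemma poly_mapping_sum_single:
  "p = (\<Sum>\<alpha>\<in>Poly_Mapping.keys p. Poly_Mapping.single \<alpha> (Poly_Mapping.lookup p \<alpha>))"
  by (rule poly_mapping_eqI)
    (auto simp: lookup_sum lookup_single when_def in_keys_iff)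

lemma mult_eq_sum_single:
  fixes p q :: "'a::monoid_add \<Rightarrow>\<^sub>0 'b::semiring_0"
  shows "p * q = (\<Sum>\<alpha>\<in>Poly_Mapping.keys p. \<Sum>\<beta>\<in>Poly_Mapping.keys q.
    Poly_Mapping.single (\<alpha> + \<beta>) (Poly_Mapping.lookup p \<alpha> * Poly_Mapping.lookup q \<beta>))"
proof -
  have "p * q = (\<Sum>\<alpha>\<in>Poly_Mapping.keys p. Poly_Mapping.single \<alpha> (Poly_Mapping.lookup p \<alpha>)) *
     (\<Sum>\<beta>\<in>Poly_Mapping.keys q. Poly_Mapping.single \<beta> (Poly_Mapping.lookup q \<beta>))"
    by (simp flip: poly_mapping_sum_single)
  then show ?thesis by (simp add: sum_product mult_single)
qed

lemma lookup_single_mult_add: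
  "Poly_Mapping.lookup (Poly_Mapping.single \<beta> c * p) (\<beta> + \<gamma>) = c * Poly_Mapping.lookup p \<gamma>"
  for p :: mpoly
proof (cases "c = 0")
  case False
  have "Poly_Mapping.lookup (Poly_Mapping.single \<beta> c * p) (\<beta> + \<gamma>) =
    (\<Sum>\<delta>\<in>Poly_Mapping.keys p. if \<delta> = \<gamma> then c * Poly_Mapping.lookup p \<delta> else 0)"
    by (subst mult_eq_sum_single) (use False in \<open>simp add: lookup_sum lookup_single when_def\<close>)
  then show ?thesis by (auto simp: in_keys_iff)
qed simp

lemma lookup_single_mult_not_add:
  fixes p :: mpoly
  assumes "\<And>\<gamma>. \<alpha> \<noteq> \<beta> + \<gamma>"
  shows "Poly_Mapping.lookup (Poly_Mapping.single \<beta> c * p) \<alpha> = 0"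
proof (cases "c = 0")
  case False
  have "\<beta> + \<gamma> \<noteq> \<alpha>" for \<gamma> using assms[of \<gamma>] by simp
  then show ?thesis
    by (subst mult_eq_sum_single) (use False in \<open>simp add: lookup_sum lookup_single when_def\<close>)
qed simp

section \<open>Substitution homomorphisms\<close>

lemma msubst_eq: "msubst e f p = (\<Sum>\<alpha> \<in> Poly_Mapping.keys p. e (Poly_Mapping.lookup p \<alpha>) * mpow f \<alpha>)"
  by (simp add: msubst_def mpow_def)

text \<open>One locale serves three coefficient maps: \<open>mconst\<close> for
  \<open>fan_iota\<close>, \<open>of_real\<close> for evaluation in the algebra, and the identity
  for values of polynomials.\<close>

locale real_ring_hom = comm_ring_hom hom for hom :: "real \<Rightarrow> 'b::comm_ring_1"
begin

lemma msubst_zero [simp]: "msubst hom f 0 = 0"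
  by (simp add: msubst_eq)

lemma msubst_add [simp]: "msubst hom f (p + q) = msubst hom f p + msubst hom f q"
  unfolding msubst_eq by (rule setsum_keys_plus_distrib) (auto simp: algebra_simps hom_distribs)

lemma msubst_single [simp]: "msubst hom f (Poly_Mapping.single \<alpha> c) = hom c * mpow f \<alpha>"
  by (simp add: msubst_eq)

lemma msubst_uminus [simp]: "msubst hom f (- p) = - msubst hom f p"
  using msubst_add[of f p "- p"] by (simp add: eq_neg_iff_add_eq_0 add.commute del: msubst_add)

lemma msubst_sum: "msubst hom f (sum g S) = (\<Sum>i\<in>S. msubst hom f (g i))"
  by (induction S rule: infinite_finite_induct) auto

lemma msubst_mult [simp]: "msubst hom f (p * q) = msubst hom f p * msubst hom f q"
proof -
  have "msubst hom f (p * q) = (\<Sum>\<alpha>\<in>Poly_Mapping.keys p. \<Sum>\<beta>\<in>Poly_Mapping.keys q.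
      hom (Poly_Mapping.lookup p \<alpha> * Poly_Mapping.lookup q \<beta>) * mpow f (\<alpha> + \<beta>))"
    by (subst mult_eq_sum_single) (simp add: msubst_sum)
  also have "\<dots> = msubst hom f p * msubst hom f q"
    unfolding msubst_eq sum_product by (intro sum.cong refl) (simp add: hom_distribs mpow_add)
  finally show ?thesis .
qed

lemma msubst_mconst [simp]: "msubst hom f (mconst c) = hom c"
  by (simp add: mconst_def)

lemma msubst_mvar [simp]: "msubst hom f (mvar i) = f i"
  by (simp add: mvar_def)

lemma msubst_one [simp]: "msubst hom f 1 = 1"
  using msubst_mconst[of f 1] by (simp add: mconst_def)

end

lemma real_ring_hom_mconst: "real_ring_hom mconst"
  by unfold_locales (auto simp: mconst_def single_add mult_single)

lemma real_ring_hom_of_real: "real_ring_hom (of_real :: real \<Rightarrow> 'a::{comm_ring_1,real_algebra_1})"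
  by unfold_locales auto

lemma real_ring_hom_id: "real_ring_hom (\<lambda>r::real. r)"
  by unfold_locales auto

lemma mconst_mult_mvar: "mconst c * mvar i = Poly_Mapping.single (Poly_Mapping.single i 1) c"
  by (simp add: mconst_def mvar_def mult_single)

lemma mpolys_in_ring:
  shows mpolys_in_zero: "0 \<in> mpolys_in S"
    and mpolys_in_one: "1 \<in> mpolys_in S"
    and mpolys_in_add: "p \<in> mpolys_in S \<Longrightarrow> q \<in> mpolys_in S \<Longrightarrow> p + q \<in> mpolys_in S"
    and mpolys_in_minus: "p \<in> mpolys_in S \<Longrightarrow> - p \<in> mpolys_in S"
    and mpolys_in_mult: "p \<in> mpolys_in S \<Longrightarrow> q \<in> mpolys_in S \<Longrightarrow> p * q \<in> mpolys_in S"
    and mpolys_in_mconst: "mconst c \<in> mpolys_in S"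
    and mpolys_in_mvar: "i \<in> S \<Longrightarrow> mvar i \<in> mpolys_in S"
proof -
  show "p * q \<in> mpolys_in S" if "p \<in> mpolys_in S" "q \<in> mpolys_in S"
    using that keys_mult[of p q] unfolding mpolys_in_def by (fastforce simp: keys_add_nat)
  show "p + q \<in> mpolys_in S" if "p \<in> mpolys_in S" "q \<in> mpolys_in S"
    using that keys_add[of p q] unfolding mpolys_in_def by fastforce
  show "- p \<in> mpolys_in S" if "p \<in> mpolys_in S"
    using that by (auto simp: mpolys_in_def in_keys_iff)
qed (auto simp: mpolys_in_def mconst_def mvar_def split: if_splits)

section \<open>Powers of linear forms and the identity theorem for polynomials\<close>

text \<open>Multinomial theorem. When one factor is split off, its term with variable
  \<open>i\<close> contributes the \<open>i\<close>-th exponent of \<open>\<alpha>\<close> times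
  \<open>fact n * mpow c \<alpha> / mfact \<alpha>\<close>; these exponents add up to the degree
  \<open>Suc n\<close>.\<close>

lemma lookup_linear_power:
  assumes S: "finite S"
  shows "Poly_Mapping.lookup ((\<Sum>i\<in>S. mconst (c i) * mvar i) ^ n) \<alpha> =
    (if Poly_Mapping.keys \<alpha> \<subseteq> S \<and> mdeg \<alpha> = n then fact n * mpow c \<alpha> / mfact \<alpha> else 0)"
proof (induction n arbitrary: \<alpha>)
  case 0
  have "\<alpha> = 0" if "mdeg \<alpha> = 0"
    using that card_keys_le_mdeg[of \<alpha>] by simp
  then show ?case
    by (auto simp: lookup_one when_def mfact_def)
next
  case (Suc n)
  let ?y = "\<Sum>i\<in>S. mconst (c i) * mvar i"
  let ?C = "Poly_Mapping.keys \<alpha> \<subseteq> S \<and> mdeg \<alpha> = Suc n"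
  have T: "Poly_Mapping.lookup (Poly_Mapping.single (Poly_Mapping.single i 1) (c i) * ?y ^ n) \<alpha> =
     (if ?C then fact n * real (Poly_Mapping.lookup \<alpha> i) * mpow c \<alpha> / mfact \<alpha> else 0)"
    if i: "i \<in> S" for i
  proof (cases "Poly_Mapping.lookup \<alpha> i = 0")
    case True
    then have "\<And>\<gamma>. \<alpha> \<noteq> Poly_Mapping.single i 1 + \<gamma>"
      by (auto simp: lookup_add)
    with True show ?thesis by (simp add: lookup_single_mult_not_add)
  next
    case False
    define \<gamma> where "\<gamma> = \<alpha> - Poly_Mapping.single i 1"
    have \<alpha>: "\<alpha> = Poly_Mapping.single i 1 + \<gamma>"
      unfolding \<gamma>_def using False
      by (intro poly_mapping_eqI) (auto simp: lookup_add lookup_minus lookup_single when_def)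
    have "Poly_Mapping.lookup (Poly_Mapping.single (Poly_Mapping.single i 1) (c i) * ?y ^ n) \<alpha> =
       c i * Poly_Mapping.lookup (?y ^ n) \<gamma>"
      unfolding \<alpha> by (rule lookup_single_mult_add)
    also have "\<dots> = (if ?C then fact n * (c i * mpow c \<gamma>) / mfact \<gamma> else 0)"
      using i unfolding Suc by (auto simp: \<alpha> keys_add_nat mdeg_add)
    also have "c i * mpow c \<gamma> = mpow c \<alpha>"
      by (simp add: \<alpha> mpow_add)
    also have "mfact \<gamma> = mfact \<alpha> / real (Poly_Mapping.lookup \<alpha> i)"
      using mfact_add_single[of \<gamma> i] by (simp add: \<alpha> lookup_add add.commute)
    finally show ?thesis using False by simp
  qed
  have factor_out: "(\<Sum>i\<in>S. if C then a * g i * b / d else 0) =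
      (if C then a * (\<Sum>i\<in>S. g i) * b / d else 0)" for C :: bool and a b d :: real and g
    by (simp add: sum_distrib_left sum_distrib_right sum_divide_distrib)
  have "Poly_Mapping.lookup (?y ^ Suc n) \<alpha> = (\<Sum>i\<in>S. 
      Poly_Mapping.lookup (Poly_Mapping.single (Poly_Mapping.single i 1) (c i) * ?y ^ n) \<alpha>)"
    by (simp add: sum_distrib_right mconst_mult_mvar lookup_sum)
  also have "\<dots> = (\<Sum>i\<in>S. if ?C then fact n * real (Poly_Mapping.lookup \<alpha> i) * mpow c \<alpha> / mfact \<alpha> else 0)"
    by (intro sum.cong refl T)
  also have "\<dots> = (if ?C then fact n * (\<Sum>i\<in>S. real (Poly_Mapping.lookup \<alpha> i)) * mpow c \<alpha> / mfact \<alpha> else 0)"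
    by (rule factor_out)
  also have "\<dots> = (if ?C then fact (Suc n) * mpow c \<alpha> / mfact \<alpha> else 0)"
    using S mdeg_eq_sum[of S \<alpha>] by (auto simp flip: of_nat_sum)
  finally show ?case .
qed

text \<open>Induction on the variables: for fixed values of the others the sum is a polynomial in
  the value of \<open>x\<close> that vanishes identically, so its coefficients vanish. Injectivity
  of the restricted exponents is the form that survives the step, where all members of the new
  \<open>K\<close> share the exponent of \<open>x\<close>.\<close>

lemma mpow_sum_eq_zero_imp:
  assumes "finite S" "finite K"
    and "inj_on (\<lambda>\<alpha>. restrict (Poly_Mapping.lookup \<alpha>) S) K"
    and "\<And>c. (\<Sum>\<alpha>\<in>K. a \<alpha> * (\<Prod>i\<in>S. c i ^ Poly_Mapping.lookup \<alpha> i)) = (0::real)"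
    and "\<alpha> \<in> K"
  shows "a \<alpha> = 0"
  using assms
proof (induction S arbitrary: K \<alpha> rule: finite_induct)
  case empty
  then have "K = {\<alpha>}" by (auto simp: inj_on_def)
  with empty show ?case by simp
next
  case (insert x S)
  define k where "k = Poly_Mapping.lookup \<alpha> x"
  let ?K = "{\<beta>\<in>K. Poly_Mapping.lookup \<beta> x = k}"
  have "(\<Sum>\<alpha>\<in>?K. a \<alpha> * (\<Prod>i\<in>S. c i ^ Poly_Mapping.lookup \<alpha> i)) = 0" for c
  proof -
    define N where "N = Max ((\<lambda>\<beta>. Poly_Mapping.lookup \<beta> x) ` K)"
    have N: "Poly_Mapping.lookup \<beta> x \<le> N" if "\<beta> \<in> K" for \<beta>
      unfolding N_def using insert.prems that by auto
    define b where "b j = (\<Sum>\<beta>\<in>{\<beta>\<in>K. Poly_Mapping.lookup \<beta> x = j}. a \<beta> *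
        (\<Prod>i\<in>S. c i ^ Poly_Mapping.lookup \<beta> i))" for j
    have "(\<Sum>j\<le>N. b j * t ^ j) = 0" for t
    proof -
      have "0 = (\<Sum>\<beta>\<in>K. a \<beta> * (\<Prod>i\<in>insert x S. (c(x := t)) i ^ Poly_Mapping.lookup \<beta> i))"
        by (simp only: insert.prems)
      also have "\<dots> = (\<Sum>\<beta>\<in>K. a \<beta> * (\<Prod>i\<in>S. c i ^ Poly_Mapping.lookup \<beta> i) * t ^ Poly_Mapping.lookup \<beta> x)"
      proof (rule sum.cong[OF refl])
        fix \<beta>
        have "(\<Prod>i\<in>S. (c(x := t)) i ^ Poly_Mapping.lookup \<beta> i) = (\<Prod>i\<in>S. c i ^ Poly_Mapping.lookup \<beta> i)"
          using insert.hyps by (intro prod.cong) auto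
        then show "a \<beta> * (\<Prod>i\<in>insert x S. (c(x := t)) i ^ Poly_Mapping.lookup \<beta> i) =
          a \<beta> * (\<Prod>i\<in>S. c i ^ Poly_Mapping.lookup \<beta> i) * t ^ Poly_Mapping.lookup \<beta> x"
          using insert.hyps by simp
      qed
      also have "\<dots> = (\<Sum>j\<le>N. \<Sum>\<beta>\<in>{\<beta>\<in>K. Poly_Mapping.lookup \<beta> x = j}.
         a \<beta> * (\<Prod>i\<in>S. c i ^ Poly_Mapping.lookup \<beta> i) * t ^ Poly_Mapping.lookup \<beta> x)"
        using insert.prems N by (intro sum.group[symmetric]) auto
      also have "\<dots> = (\<Sum>j\<le>N. b j * t ^ j)"
        unfolding b_def sum_distrib_right by (intro sum.cong) auto
      finally show ?thesis by simp
    qed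
    then have "\<forall>j\<le>N. b j = 0" using polyfun_eq_0[of b N] by blast
    moreover have "k \<le> N" unfolding k_def using N insert.prems by auto
    ultimately show ?thesis by (simp add: b_def)
  qed
  moreover have "inj_on (\<lambda>\<alpha>. restrict (Poly_Mapping.lookup \<alpha>) S) ?K"
  proof (rule inj_onI)
    fix \<beta> \<gamma> assume *: "\<beta> \<in> ?K" "\<gamma> \<in> ?K"
      "restrict (Poly_Mapping.lookup \<beta>) S = restrict (Poly_Mapping.lookup \<gamma>) S"
    then have "restrict (Poly_Mapping.lookup \<beta>) (insert x S) = restrict (Poly_Mapping.lookup \<gamma>) (insert x S)"
      by (auto simp: fun_eq_iff restrict_def split: if_splits)
    with * show "\<beta> = \<gamma>" using inj_onD[OF insert.prems(2), of \<beta> \<gamma>] by simp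
  qed
  moreover have "finite ?K" "\<alpha> \<in> ?K" using insert.prems by (auto simp: k_def)
  ultimately show ?case by (intro insert.IH[of ?K \<alpha>])
qed

text \<open>Applies \<open>mpow_sum_eq_zero_imp\<close> to the difference. This is the uniqueness in
  the definite description of \<open>volume_polynomial\<close>.\<close>

lemma mpoly_eqI_values:
  assumes S: "finite S" and "p \<in> mpolys_in S" "q \<in> mpolys_in S"
    and eq: "\<And>c. msubst (\<lambda>r. r) c p = msubst (\<lambda>r. r) c q"
  shows "p = q"
proof -
  let ?d = "p + (- q)"
  have d: "?d \<in> mpolys_in S" by (intro mpolys_in_ring assms)
  have "msubst (\<lambda>r. r) c ?d = 0" for c
    using eq[of c] by (simp add: real_ring_hom.msubst_add real_ring_hom.msubst_uminus real_ring_hom_id del: add_uminus_conv_diff)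
  then have z: "(\<Sum>\<alpha>\<in>Poly_Mapping.keys ?d. Poly_Mapping.lookup ?d \<alpha> * (\<Prod>i\<in>S. c i ^ Poly_Mapping.lookup \<alpha> i)) = 0" for c
  proof -
    have "(\<Sum>\<alpha>\<in>Poly_Mapping.keys ?d. Poly_Mapping.lookup ?d \<alpha> * (\<Prod>i\<in>S. c i ^ Poly_Mapping.lookup \<alpha> i)) = msubst (\<lambda>r. r) c ?d"
      unfolding msubst_eq using d
      by (intro sum.cong refl) (simp add: mpow_eq_prod[OF S] mpolys_in_def)
    then show ?thesis using \<open>msubst (\<lambda>r. r) c ?d = 0\<close> by simp
  qed
  have inj: "inj_on (\<lambda>\<alpha>. restrict (Poly_Mapping.lookup \<alpha>) S) (Poly_Mapping.keys ?d)"
  proof (rule inj_onI, rule poly_mapping_eqI)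
    fix \<alpha> \<beta> i assume *: "\<alpha> \<in> Poly_Mapping.keys ?d" "\<beta> \<in> Poly_Mapping.keys ?d"
      "restrict (Poly_Mapping.lookup \<alpha>) S = restrict (Poly_Mapping.lookup \<beta>) S"
    have "Poly_Mapping.keys \<alpha> \<subseteq> S" "Poly_Mapping.keys \<beta> \<subseteq> S"
      using * d by (auto simp: mpolys_in_def)
    then show "Poly_Mapping.lookup \<alpha> i = Poly_Mapping.lookup \<beta> i"
      using fun_cong[OF *(3), of i] by (cases "i \<in> S") (simp, metis in_keys_iff subsetD)
  qed
  have "Poly_Mapping.lookup ?d \<alpha> = 0" for \<alpha>
    using mpow_sum_eq_zero_imp[where a = "Poly_Mapping.lookup ?d", OF S finite_keys inj z, of \<alpha>] by (cases "\<alpha> \<in> Poly_Mapping.keys ?d") (auto simp: in_keys_iff)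
  then have "?d = 0" by (intro poly_mapping_eqI) simp
  then show ?thesis by simp
qed

section \<open>Differential operators in terms of coefficients\<close>

lemma lookup_mpderiv:
  "Poly_Mapping.lookup (mpderiv i p) \<alpha> =
   real (Poly_Mapping.lookup \<alpha> i + 1) * Poly_Mapping.lookup p (\<alpha> + Poly_Mapping.single i 1)"
proof -
  have "Poly_Mapping.lookup (mpderiv i p) \<alpha> = (\<Sum>\<beta>\<in>Poly_Mapping.keys p.
    if \<beta> = \<alpha> + Poly_Mapping.single i 1 then real (Poly_Mapping.lookup \<beta> i) * Poly_Mapping.lookup p \<beta> else 0)"
    unfolding mpderiv_def lookup_sum
  proof (rule sum.cong[OF refl])
    fix \<beta>
    show "Poly_Mapping.lookup (Poly_Mapping.single (\<beta> - Poly_Mapping.single i 1)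
        (of_nat (Poly_Mapping.lookup \<beta> i) * Poly_Mapping.lookup p \<beta>)) \<alpha> =
      (if \<beta> = \<alpha> + Poly_Mapping.single i 1 then real (Poly_Mapping.lookup \<beta> i) * Poly_Mapping.lookup p \<beta> else 0)"
    proof (cases "Poly_Mapping.lookup \<beta> i = 0")
      case False
      define \<gamma> where "\<gamma> = \<beta> - Poly_Mapping.single i 1"
      have \<beta>: "\<beta> = \<gamma> + Poly_Mapping.single i 1"
        unfolding \<gamma>_def using False
        by (intro poly_mapping_eqI) (auto simp: lookup_add lookup_minus lookup_single when_def)
      then have "\<beta> - Poly_Mapping.single i 1 = \<gamma>" by simp
      then show ?thesis by (auto simp: lookup_single when_def \<beta>)
    next
      \<comment> \<open>Truncated subtraction leaves \<open>\<beta>\<close> unchanged here, so it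
        may coincide with \<open>\<alpha>\<close>, but then the coefficient has the factor
        0.\<close>
      case True
      then show ?thesis by (auto simp: lookup_single lookup_add)
    qed
  qed
  also have "\<dots> = real (Poly_Mapping.lookup \<alpha> i + 1) * Poly_Mapping.lookup p (\<alpha> + Poly_Mapping.single i 1)"
    by (auto simp: in_keys_iff lookup_add)
  finally show ?thesis .
qed

text \<open>The value at 0 of the derivative of \<open>p\<close> with multi-index
  \<open>\<alpha>\<close>. In these numbers differentiation is a mere shift of the index, without
  factors.\<close>

definition dcoeff :: "mpoly \<Rightarrow> (nat \<Rightarrow>\<^sub>0 nat) \<Rightarrow> real" where
  "dcoeff p \<alpha> = mfact \<alpha> * Poly_Mapping.lookup p \<alpha>"

lemma dcoeff_mpderiv: "dcoeff (mpderiv i p) \<alpha> = dcoeff p (\<alpha> + Poly_Mapping.single i 1)"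
  using mfact_add_single[of \<alpha> i] by (simp add: dcoeff_def lookup_mpderiv)

lemma dcoeff_mpderiv_power:
  "dcoeff ((mpderiv i ^^ k) p) \<alpha> = dcoeff p (\<alpha> + Poly_Mapping.single i k)"
proof (induction k arbitrary: \<alpha>)
  case (Suc k)
  have "\<alpha> + Poly_Mapping.single i 1 + Poly_Mapping.single i k = \<alpha> + Poly_Mapping.single i (Suc k)"
    by (simp add: add.assoc flip: single_add)
  then show ?case using Suc[of "\<alpha> + Poly_Mapping.single i 1"] by (simp add: dcoeff_mpderiv)
qed simp

lemma dcoeff_mpderiv_multi: "dcoeff (mpderiv_multi \<gamma> p) \<alpha> = dcoeff p (\<alpha> + \<gamma>)"
proof -
  have "dcoeff (foldr (\<lambda>i. mpderiv i ^^ Poly_Mapping.lookup \<gamma> i) xs p) \<alpha> =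
     dcoeff p (\<alpha> + (\<Sum>i\<leftarrow>xs. Poly_Mapping.single i (Poly_Mapping.lookup \<gamma> i)))" for xs
    by (induction xs arbitrary: \<alpha>) (auto simp: dcoeff_mpderiv_power add_ac)
  moreover have "(\<Sum>i\<leftarrow>sorted_list_of_set (Poly_Mapping.keys \<gamma>). Poly_Mapping.single i (Poly_Mapping.lookup \<gamma> i)) = \<gamma>"
    by (subst sum_list_distinct_conv_sum_set) (auto simp flip: poly_mapping_sum_single)
  ultimately show ?thesis by (simp add: mpderiv_multi_def)
qed

text \<open>A polynomial vanishes iff all its derivatives at 0 do. If \<open>dcoeff p\<close> is
  viewed as a linear functional on monomials, the condition says that it kills all monomial
  multiples of \<open>D\<close>.\<close>

lemma apply_diff_eq_0_iff:
  "apply_diff D p = 0 \<longleftrightarrow>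
    (\<forall>\<beta>. (\<Sum>\<alpha>\<in>Poly_Mapping.keys D. Poly_Mapping.lookup D \<alpha> * dcoeff p (\<alpha> + \<beta>)) = 0)"
proof -
  have lk: "Poly_Mapping.lookup (mconst c * q) \<beta> = c * Poly_Mapping.lookup q \<beta>" for c q \<beta>
    using lookup_single_mult_add[of 0 c q \<beta>] by (simp add: mconst_def)
  have "mfact \<beta> * Poly_Mapping.lookup (apply_diff D p) \<beta> =
    (\<Sum>\<alpha>\<in>Poly_Mapping.keys D. Poly_Mapping.lookup D \<alpha> * dcoeff p (\<alpha> + \<beta>))" for \<beta>
  proof -
    have "mfact \<beta> * Poly_Mapping.lookup (apply_diff D p) \<beta> =
      (\<Sum>\<alpha>\<in>Poly_Mapping.keys D. Poly_Mapping.lookup D \<alpha> * dcoeff (mpderiv_multi \<alpha> p) \<beta>)"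
      unfolding apply_diff_def lookup_sum lk sum_distrib_left dcoeff_def
      by (intro sum.cong refl) simp
    then show ?thesis by (simp add: dcoeff_mpderiv_multi add.commute)
  qed
  moreover have "apply_diff D p = 0 \<longleftrightarrow> (\<forall>\<beta>. mfact \<beta> * Poly_Mapping.lookup (apply_diff D p) \<beta> = 0)"
    by (auto simp: poly_mapping_eq_iff fun_eq_iff)
  ultimately show ?thesis by simp
qed

section \<open>Multi-fans on the moment curve\<close>

definition moment_vec :: "nat \<Rightarrow> nat \<Rightarrow> real vec" where
  "moment_vec n i = vec n (\<lambda>k. real i ^ k)"

lemma moment_vec_carrier [simp]: "moment_vec n i \<in> carrier_vec n"
  by (simp add: moment_vec_def)

text \<open>The vector \<open>u\<close> is read as the coefficients of a polynomial, and the pairing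
  is its value at \<open>j\<close>. Independence becomes a matter of counting roots, and dual bases
  a matter of interpolation.\<close>

lemma scalar_prod_moment_vec: "u \<bullet> moment_vec n j = (\<Sum>k<n. u $ k * real j ^ k)"
  by (simp add: moment_vec_def scalar_prod_def atLeast0LessThan)

text \<open>A polynomial of degree less than \<open>n\<close> with \<open>n\<close> roots is
  zero.\<close>

lemma moment_vec_orthogonal_imp_zero:
  assumes I: "finite I" "card I = n" and u: "u \<in> carrier_vec n"
    and orth: "\<And>j. j \<in> I \<Longrightarrow> u \<bullet> moment_vec n j = 0"
  shows "u = 0\<^sub>v n"
proof (cases "n = 0")
  case True
  then show ?thesis using u by auto
next
  case False
  define p where "p = (\<Sum>k<n. Polynomial.monom (u $ k) k)"
  have coeff_p: "Polynomial.coeff p k = (if k < n then u $ k else 0)" for k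
    by (auto simp: p_def Polynomial.coeff_sum)
  have "Polynomial.degree p \<le> n - 1"
    by (rule Polynomial.degree_le) (use False in \<open>auto simp: coeff_p\<close>)
  have "p = 0"
  proof (rule Polynomial.poly_eqI_degree)
    show "Polynomial.poly p x = Polynomial.poly 0 x" if "x \<in> real ` I" for x
      using that orth by (auto simp: p_def Polynomial.poly_sum Polynomial.poly_monom scalar_prod_moment_vec)
    have "card (real ` I) = n" using I by (simp add: card_image)
    then show "card (real ` I) > Polynomial.degree p" "card (real ` I) > Polynomial.degree (0 :: real Polynomial.poly)"
      using \<open>Polynomial.degree p \<le> n - 1\<close> False by auto
  qed
  then have "u $ k = 0" if "k < n" for k
    using coeff_p[of k] that by simp
  with u show ?thesis by (intro eq_vecI) auto
qed

text \<open>The dual basis consists of the coefficient vectors of the Lagrange polynomials.\<close>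

lemma dual_vec_moment_exists:
  assumes I: "finite I" "card I = n" "i \<in> I"
  shows "\<exists>u. u \<in> carrier_vec n \<and> (\<forall>j\<in>I. u \<bullet> moment_vec n j = (if j = i then 1 else 0))"
proof -
  define q where "q = (\<Prod>j\<in>I - {i}. [:- real j, 1:])"
  have q: "Polynomial.poly q x = (\<Prod>j\<in>I - {i}. x - real j)" for x
    by (simp add: q_def Polynomial.poly_prod)
  have deg: "Polynomial.degree q < n"
  proof -
    have "Polynomial.degree q \<le> (\<Sum>j\<in>I - {i}. Polynomial.degree [:- real j, 1:])"
      unfolding q_def using I Polynomial.degree_prod_sum_le[of "I - {i}" "\<lambda>j. [:- real j, 1:]"] by (simp add: o_def)
    also have "\<dots> = n - 1" using I by simp
    also have "\<dots> < n" using I card_gt_0_iff[of I] by auto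
    finally show ?thesis .
  qed
  define d where "d = Polynomial.poly q (real i)"
  have d: "d \<noteq> 0" using I by (auto simp: d_def q)
  let ?u = "vec n (\<lambda>k. Polynomial.coeff q k / d)"
  have u: "?u \<bullet> moment_vec n j = Polynomial.poly q (real j) / d" for j
  proof -
    have "(\<Sum>k<n. Polynomial.coeff q k * real j ^ k) = Polynomial.poly q (real j)"
      unfolding Polynomial.poly_altdef using deg
      by (intro sum.mono_neutral_right) (auto simp: Polynomial.coeff_eq_0)
    then show ?thesis
      by (simp add: scalar_prod_moment_vec sum_divide_distrib[symmetric])
  qed
  have "?u \<bullet> moment_vec n j = (if j = i then 1 else 0)" if "j \<in> I" for j
    using that d I unfolding u by (auto simp: d_def q)
  then show ?thesis by (intro exI[of _ ?u]) auto
qed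

text \<open>Two candidates differ by a vector orthogonal to \<open>n\<close> moment vectors, hence
  by zero; so the description in \<open>dual_vec\<close> picks the Lagrange vector.\<close>

lemma dual_vec_moment:
  assumes I: "finite I" "card I = n" "i \<in> I"
  shows dual_vec_moment_carrier: "dual_vec n (moment_vec n) I i \<in> carrier_vec n"
    and dual_vec_moment_prod: "j \<in> I \<Longrightarrow>
      dual_vec n (moment_vec n) I i \<bullet> moment_vec n j = (if j = i then 1 else 0)"
proof -
  let ?P = "\<lambda>u. u \<in> carrier_vec n \<and> (\<forall>j\<in>I. u \<bullet> moment_vec n j = (if j = i then 1 else 0))"
  have "\<exists>!u. ?P u"
  proof (rule ex_ex1I[OF dual_vec_moment_exists[OF I]])
    fix u v assume u: "?P u" and v: "?P v"
    have "u - v = 0\<^sub>v n"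
      using u v
      by (intro moment_vec_orthogonal_imp_zero[OF I(1,2)])
         (auto simp: minus_scalar_prod_distrib[of _ n])
    then have "u $ k - v $ k = 0" if "k < n" for k
      using u v that by (metis carrier_vecD index_minus_vec(1) index_zero_vec(1))
    then show "u = v" using u v by (intro eq_vecI) auto
  qed
  from theI'[OF this] show "dual_vec n (moment_vec n) I i \<in> carrier_vec n"
    "j \<in> I \<Longrightarrow> dual_vec n (moment_vec n) I i \<bullet> moment_vec n j = (if j = i then 1 else 0)"
    unfolding dual_vec_def by auto
qed

text \<open>Lagrange interpolation: the difference of the two sides is a polynomial vanishing at the
  \<open>n\<close> nodes in \<open>I\<close>.\<close>

lemma dual_vec_moment_expansion:
  assumes I: "finite I" "card I = n" and v: "v \<in> carrier_vec n" and k: "k < n"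
  shows "v $ k = (\<Sum>i\<in>I. (v \<bullet> moment_vec n i) * dual_vec n (moment_vec n) I i $ k)"
proof -
  let ?d = "dual_vec n (moment_vec n) I"
  define u where "u = vec n (\<lambda>k. v $ k - (\<Sum>i\<in>I. (v \<bullet> moment_vec n i) * ?d i $ k))"
  have "u \<bullet> moment_vec n j = 0" if j: "j \<in> I" for j
  proof -
    have "u \<bullet> moment_vec n j = v \<bullet> moment_vec n j -
        (\<Sum>k<n. \<Sum>i\<in>I. (v \<bullet> moment_vec n i) * (?d i $ k * real j ^ k))"
      by (simp add: u_def scalar_prod_moment_vec left_diff_distrib sum_subtractf sum_distrib_right
          mult.assoc)
    also have "(\<Sum>k<n. \<Sum>i\<in>I. (v \<bullet> moment_vec n i) * (?d i $ k * real j ^ k)) =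
        (\<Sum>i\<in>I. (v \<bullet> moment_vec n i) * (?d i \<bullet> moment_vec n j))"
      by (subst sum.swap) (simp add: scalar_prod_moment_vec[of _ n j] sum_distrib_left)
    also have "\<dots> = (\<Sum>i\<in>I. if j = i then v \<bullet> moment_vec n i else 0)"
      using j I by (intro sum.cong refl) (simp add: dual_vec_moment_prod)
    also have "\<dots> = v \<bullet> moment_vec n j" using I j by simp
    finally show ?thesis by simp
  qed
  then have "u = 0\<^sub>v n"
    by (intro moment_vec_orthogonal_imp_zero[OF I]) (auto simp: u_def)
  then have "u $ k = 0" using k by simp
  then show ?thesis using k by (simp add: u_def)
qed

text \<open>A kernel vector of the transposed matrix is orthogonal to all columns, hence zero; the
  Vandermonde determinant itself is never evaluated.\<close>

lemma fan_det_moment_nonzero: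
  assumes I: "finite I" "card I = n"
  shows "fan_det n (moment_vec n) I \<noteq> 0"
proof
  let ?xs = "sorted_list_of_set I"
  let ?M = "mat_of_cols n (map (moment_vec n) ?xs)"
  assume "fan_det n (moment_vec n) I = 0"
  have M: "?M \<in> carrier_mat n n" using I mat_of_cols_carrier(1)[of n "map (moment_vec n) ?xs"] by simp
  then have "det (transpose_mat ?M) = 0"
    using \<open>fan_det n (moment_vec n) I = 0\<close> by (simp add: fan_det_def det_transpose)
  then obtain v where v: "v \<in> carrier_vec n" "v \<noteq> 0\<^sub>v n" "transpose_mat ?M *\<^sub>v v = 0\<^sub>v n"
    using det_0_iff_vec_prod_zero[of "transpose_mat ?M" n] M by auto
  have "v \<bullet> moment_vec n j = 0" if j: "j \<in> I" for j
  proof -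
    obtain k where k: "k < n" "?xs ! k = j"
      using j I in_set_conv_nth[of j ?xs] by auto
    have "0 = (transpose_mat ?M *\<^sub>v v) $ k" by (simp only: v(3)) (simp add: k)
    also have "\<dots> = row (transpose_mat ?M) k \<bullet> v" by (rule index_mult_mat_vec) (use k I in simp)
    also have "row (transpose_mat ?M) k = col ?M k" by (rule row_transpose) (use k I in simp)
    also have "col ?M k = moment_vec n j" using k I by (subst col_mat_of_cols) auto
    finally show ?thesis using comm_scalar_prod[of v n "moment_vec n j"] v by simp
  qed
  then have "v = 0\<^sub>v n" by (rule moment_vec_orthogonal_imp_zero[OF I v(1)])
  with v show False by simp
qed

lemma moment_vec_inj_on:
  assumes I: "finite I" "card I = n"
  shows "inj_on (moment_vec n) I"
proof (rule inj_onI)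
  fix i j assume ij: "i \<in> I" "j \<in> I" "moment_vec n i = moment_vec n j"
  have "(if j = i then 1 else 0) = dual_vec n (moment_vec n) I i \<bullet> moment_vec n j"
    using dual_vec_moment_prod[OF I ij(1) ij(2)] by (rule sym)
  also have "\<dots> = 1"
    using dual_vec_moment_prod[OF I ij(1) ij(1)] unfolding ij(3) by simp
  finally show "i = j" by (simp split: if_splits)
qed

lemma moment_vec_basis:
  assumes I: "finite I" "card I = n"
  shows "vectorspace.basis class_ring (module_vec TYPE(real) n) (moment_vec n ` I)"
proof -
  interpret vec_space "TYPE(real)" n .
  let ?vs = "map (moment_vec n) (sorted_list_of_set I)"
  let ?M = "mat_of_rows n ?vs"
  have M: "?M \<in> carrier_mat n n" using I by (intro carrier_matI) auto
  have "det ?M = fan_det n (moment_vec n) I"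
    unfolding fan_det_def transpose_mat_of_rows[symmetric] using M by (simp add: det_transpose)
  then have "lin_indpt (set (rows ?M))"
    using det_not_0_imp_lin_indpt_rows[OF M] fan_det_moment_nonzero[OF I] by simp
  moreover have "set (rows ?M) = moment_vec n ` I"
    using I by (subst rows_mat_of_rows) auto
  ultimately show ?thesis
    using I by (intro dim_li_is_basis) (auto simp: dim_is_n card_image moment_vec_inj_on)
qed

text \<open>Expanding \<open>fan_det n lam (insert v J)\<close> along the column of \<open>v\<close> yields the same
  linear form in \<open>lam v\<close> for all \<open>v\<close>, up to the sign in \<open>chain_boundary\<close>.\<close>

lemma fan_det_insert:
  assumes n: "n \<ge> 1" and J: "finite J" "card J = n - 1"
    and lam: "\<And>i. lam i \<in> carrier_vec n"
  obtains f where "f \<in> carrier_vec n"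
    "\<And>v. v \<notin> J \<Longrightarrow> (-1) ^ card {j \<in> J. j < v} * fan_det n lam (insert v J) = f \<bullet> lam v"
    "\<And>j. j \<in> J \<Longrightarrow> f \<bullet> lam j = 0"
proof -
  define ys where "ys = map lam (sorted_list_of_set J)"
  have len: "length ys = n - 1" using J by (simp add: ys_def)
  define M where "M p x = mat_of_cols n (take p ys @ x # drop p ys)" for p x
  have M: "M p x \<in> carrier_mat n n" for p x
  proof -
    have "length (take p ys @ x # drop p ys) = n" using len n by simp
    then show ?thesis using mat_of_cols_carrier(1)[of n "take p ys @ x # drop p ys"] by (simp add: M_def)
  qed
  \<comment> \<open>Deleting the column of the inserted vector leaves the columns \<open>ys\<close>,
    whatever the vector and its place, so all minors can be read off one matrix with a zero vector
    at place 0. The vector \<open>f\<close> below consists of these minors with signs.\<close>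
  define E where "E i = mat_delete (M 0 (0\<^sub>v n)) i 0" for i
  have E: "mat_delete (M p x) i p = E i" if "p < n" for p x i
  proof (rule eq_matI)
    fix r s assume rs: "r < dim_row (E i)" "s < dim_col (E i)"
    then have rs': "r < n - 1" "s < n - 1" using carrier_matD[OF M[of 0 "0\<^sub>v n"]] by (auto simp: E_def)
    show "mat_delete (M p x) i p $$ (r, s) = E i $$ (r, s)"
      using rs' that len M[of p x] M[of 0 "0\<^sub>v n"] unfolding E_def mat_delete_def
      by (auto simp: M_def mat_of_cols_index nth_append min_def)
  qed (use carrier_matD[OF M] in \<open>simp_all add: E_def\<close>)
  define f where "f = vec n (\<lambda>i. (-1) ^ i * det (E i))"
  have det_M: "(-1) ^ p * det (M p x) = f \<bullet> x" if p: "p < n" and x: "x \<in> carrier_vec n" for p x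
  proof -
    have "det (M p x) = (\<Sum>i<n. x $ i * ((-1) ^ (i + p) * det (E i)))"
      unfolding laplace_expansion_column[OF M p] cofactor_def E[OF p]
      using p len by (intro sum.cong refl) (simp add: M_def mat_of_cols_index nth_append)
    also have "\<dots> = (-1) ^ p * (f \<bullet> x)"
      using x by (simp add: scalar_prod_def f_def sum_distrib_left power_add algebra_simps atLeast0LessThan)
    finally show ?thesis by simp
  qed
  show thesis
  proof
    show "f \<in> carrier_vec n" by (simp add: f_def)
  next
    fix v assume v: "v \<notin> J"
    \<comment> \<open>In increasing order, \<open>v\<close> comes right after its \<open>?p\<close>
      predecessors in \<open>J\<close>, so its column has number \<open>?p\<close>, which is also
      the exponent in \<open>chain_boundary\<close>.\<close>
    let ?A = "sorted_list_of_set {j\<in>J. j < v}" and ?B = "sorted_list_of_set {j\<in>J. v < j}"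
    let ?p = "card {j \<in> J. j < v}"
    have fin: "finite {j\<in>J. j < v}" "finite {j\<in>J. v < j}" using J by auto
    have split: "J = {j\<in>J. j < v} \<union> {j\<in>J. v < j}"
      using v by (auto simp: not_less le_less)
    have sorted: "sorted (?A @ ?B)" "sorted (?A @ v # ?B)"
      using fin by (auto simp: sorted_append)
    have "set (?A @ ?B) = J"
      by (simp only: set_append set_sorted_list_of_set[OF fin(1)] set_sorted_list_of_set[OF fin(2)]
          split[symmetric])
    moreover from this have "set (?A @ v # ?B) = insert v J" by auto
    moreover have "distinct (?A @ ?B)" "distinct (?A @ v # ?B)"
      using fin by auto
    ultimately have 1: "sorted_list_of_set J = ?A @ ?B"
      and 2: "sorted_list_of_set (insert v J) = ?A @ v # ?B"
      using sorted by (metis sorted_list_of_set.idem_if_sorted_distinct)+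
    have "?p \<le> card J" using J by (intro card_mono) auto
    then have p: "?p < n" using J n by simp
    have "fan_det n lam (insert v J) = det (M ?p (lam v))"
      unfolding fan_det_def 2 M_def ys_def 1 by simp
    with det_M[OF p lam] show "(-1) ^ ?p * fan_det n lam (insert v J) = f \<bullet> lam v" by simp
  next
    fix j assume "j \<in> J"
    then obtain k where k: "k < n - 1" "ys ! k = lam j"
      using J by (metis in_set_conv_nth length_map length_sorted_list_of_set nth_map set_sorted_list_of_set ys_def)
    \<comment> \<open>A vector of \<open>J\<close> inserted at place 0 occurs twice; its old column
      \<open>k\<close> has moved to \<open>Suc k\<close>.\<close>
    have "det (M 0 (lam j)) = 0"
    proof (rule det_identical_columns[OF M])
      show "col (M 0 (lam j)) 0 = col (M 0 (lam j)) (Suc k)"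
        unfolding M_def using k len lam by (subst (1 2) col_mat_of_cols) auto
    qed (use k in auto)
    then show "f \<bullet> lam j = 0" using det_M[of 0 "lam j"] n lam by simp
  qed
qed

text \<open>Lagrange interpolation of the \<open>k\<close>-th power at the nodes in
  \<open>I\<close>, evaluated at \<open>j\<close>. With \<open>I = {1..n}\<close> it serves to solve
  the linear relations for the first \<open>n\<close> elements of the algebra.\<close>

lemma moment_vec_expansion:
  assumes I: "finite I" "card I = n" and k: "k < n"
  shows "(\<Sum>i\<in>I. real i ^ k * (dual_vec n (moment_vec n) I i \<bullet> moment_vec n j)) = real j ^ k"
proof -
  let ?d = "dual_vec n (moment_vec n) I"
  have e: "unit_vec n k \<bullet> moment_vec n i = real i ^ k" for i
    using k by (simp add: moment_vec_def)
  have "real j ^ k = (\<Sum>t<n. unit_vec n k $ t * real j ^ t)"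
    unfolding scalar_prod_moment_vec[symmetric] by (rule e[symmetric])
  also have "\<dots> = (\<Sum>t<n. (\<Sum>i\<in>I. real i ^ k * ?d i $ t) * real j ^ t)"
    using dual_vec_moment_expansion[OF I unit_vec_carrier] by (intro sum.cong refl) (simp only: e lessThan_iff)
  also have "\<dots> = (\<Sum>i\<in>I. real i ^ k * (?d i \<bullet> moment_vec n j))"
    unfolding scalar_prod_moment_vec sum_distrib_left sum_distrib_right
    by (subst sum.swap) (simp add: mult.assoc)
  finally show ?thesis by simp
qed

section \<open>Square-free monomials and linear forms\<close>

definition sqf :: "nat set \<Rightarrow> nat \<Rightarrow>\<^sub>0 nat" where
  "sqf I = (\<Sum>i\<in>I. Poly_Mapping.single i 1)"

lemma lookup_sqf: "finite I \<Longrightarrow> Poly_Mapping.lookup (sqf I) i = (if i \<in> I then 1 else 0)"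
  by (simp add: sqf_def lookup_sum lookup_single when_def)

lemma keys_sqf: "finite I \<Longrightarrow> Poly_Mapping.keys (sqf I) = I"
  by (auto simp: in_keys_iff lookup_sqf split: if_splits)

lemma sqf_insert: "finite J \<Longrightarrow> v \<notin> J \<Longrightarrow> sqf (insert v J) = sqf J + Poly_Mapping.single v 1"
  by (simp add: sqf_def add.commute)

lemma mpow_sqf: "finite I \<Longrightarrow> mpow f (sqf I) = (\<Prod>i\<in>I. f i)"
  by (simp add: mpow_def keys_sqf lookup_sqf)

text \<open>Every exponent on the support is at least 1, so the degree leaves no room for an
  exponent 2.\<close>

lemma mdeg_le_card_keys_imp_sqf:
  assumes "mdeg \<alpha> \<le> card (Poly_Mapping.keys \<alpha>)"
  shows "\<alpha> = sqf (Poly_Mapping.keys \<alpha>)"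
proof -
  have "mdeg \<alpha> = (\<Sum>i\<in>Poly_Mapping.keys \<alpha>. 1)"
    using assms card_keys_le_mdeg[of \<alpha>] by simp
  then have "Poly_Mapping.lookup \<alpha> i = 1" if "i \<in> Poly_Mapping.keys \<alpha>" for i
    using sum_mono_inv[of "\<lambda>i. 1" "Poly_Mapping.keys \<alpha>" "Poly_Mapping.lookup \<alpha>" i] that
    by (auto simp: mdeg_def in_keys_iff Suc_leI)
  then show ?thesis
    by (intro poly_mapping_eqI) (auto simp: lookup_sqf in_keys_iff)
qed

lemma mconst_eq_iff [simp]: "mconst a = mconst b \<longleftrightarrow> a = b"
  unfolding mconst_def by (metis lookup_single_eq)

lemma mconst_0 [simp]: "mconst 0 = 0"
  by (simp add: mconst_def)

lemma mconst_eq_0_iff: "mconst a = 0 \<longleftrightarrow> a = 0"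
  using mconst_eq_iff[of a 0] by (simp del: mconst_eq_iff)

lemma mconst_1 [simp]: "mconst 1 = 1"
  by (simp add: mconst_def)

lemma mconst_add: "mconst (a + b) = mconst a + mconst b"
  by (simp add: mconst_def single_add)

lemma mconst_mult: "mconst (a * b) = mconst a * mconst b"
  by (simp add: mconst_def mult_single)

lemma mconst_sum: "mconst (sum f S) = (\<Sum>i\<in>S. mconst (f i))"
  by (induction S rule: infinite_finite_induct) (auto simp: mconst_add)

lemma single_one_eq_iff [simp]:
  "Poly_Mapping.single i (Suc 0) = Poly_Mapping.single j (Suc 0) \<longleftrightarrow> i = j"
  by (metis keys_single old.nat.distinct(2) singleton_inject)

lemma linear_form_eq_0_iff:
  assumes "u \<in> carrier_vec n"
  shows "linear_form n u = 0 \<longleftrightarrow> u = 0\<^sub>v n"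
proof
  assume *: "linear_form n u = 0"
  have "u $ k = 0" if "k < n" for k
  proof -
    have "0 = Poly_Mapping.lookup (linear_form n u) (Poly_Mapping.single k 1)"
      by (simp add: *)
    also have "\<dots> = (\<Sum>j<n. if j = k then u $ j else 0)"
      unfolding linear_form_def mconst_mult_mvar lookup_sum
      by (intro sum.cong refl) (auto simp: lookup_single when_def)
    finally show ?thesis using that by simp
  qed
  then show "u = 0\<^sub>v n" using assms by (intro eq_vecI) auto
qed (simp add: linear_form_def)

section \<open>The multi-fan of a functional\<close>

text \<open>\<open>L\<close> lists the values of a linear functional on monomials.
  \<open>relation\<close> treats the coordinate forms only and extends to all linear forms by
  \<open>relation_vec\<close>; \<open>n_le_m\<close> allows a support with fewer than
  \<open>n\<close> elements to be enlarged to a simplex.\<close>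

locale moment_functional =
  fixes n m :: nat and L :: "(nat \<Rightarrow>\<^sub>0 nat) \<Rightarrow> real"
  assumes n_pos: "n \<ge> 1" and n_le_m: "n \<le> m"
    and support: "L \<alpha> \<noteq> 0 \<Longrightarrow> mdeg \<alpha> = n"
    and relation: "k < n \<Longrightarrow> (\<Sum>j=1..m. real j ^ k * L (\<alpha> + Poly_Mapping.single j 1)) = 0"
begin

text \<open>To the integral of the square-free monomial of \<open>I\<close> only the cone
  \<open>I\<close> contributes, namely its weight divided by the volume; this dictates the
  formula.\<close>

definition weight :: "nat set \<Rightarrow> real" where
  "weight I = \<bar>fan_det n (moment_vec n) I\<bar> * L (sqf I)"

definition simplices :: "nat set set" where
  "simplices = {I. I \<subseteq> {1..m} \<and> card I = n}"

lemma finite_simplices: "finite simplices"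
  by (rule finite_subset[of _ "Pow {1..m}"]) (auto simp: simplices_def)

lemma simplices_D:
  assumes "I \<in> simplices"
  shows "finite I" "card I = n" "I \<subseteq> {1..m}"
  using assms by (auto simp: simplices_def intro: finite_subset)

lemma relation_vec: "(\<Sum>j=1..m. (v \<bullet> moment_vec n j) * L (\<alpha> + Poly_Mapping.single j 1)) = 0"
proof -
  have "(\<Sum>j=1..m. (v \<bullet> moment_vec n j) * L (\<alpha> + Poly_Mapping.single j 1)) =
    (\<Sum>k<n. v $ k * (\<Sum>j=1..m. real j ^ k * L (\<alpha> + Poly_Mapping.single j 1)))"
    unfolding scalar_prod_moment_vec sum_distrib_left sum_distrib_right
    by (subst sum.swap) (simp add: mult.assoc)
  then show ?thesis using relation by simp
qed

text \<open>The orientation sign turns the absolute value in \<open>weight\<close> back into the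
  determinant. With the form \<open>f\<close> of \<open>fan_det_insert\<close>, the boundary at
  \<open>J\<close> is then \<open>relation_vec\<close> for \<open>f\<close> and the monomial of
  \<open>J\<close>; the missing terms with \<open>v\<close> in \<open>J\<close> vanish because
  \<open>f\<close> does.\<close>

theorem complete_multi_fan_weight: "complete_multi_fan n m weight (moment_vec n)"
  unfolding complete_multi_fan_def
proof (intro conjI ballI allI impI)
  fix I assume "I \<in> fan_cones n m weight"
  then have "I \<in> simplices" by (auto simp: fan_cones_def simplices_def)
  from simplices_D[OF this]
  show "inj_on (moment_vec n) I"
    "vectorspace.basis class_ring (module_vec TYPE(real) n) (moment_vec n ` I)"
    by (simp_all add: moment_vec_inj_on moment_vec_basis)
next
  fix J assume J: "J \<subseteq> {1..m} \<and> card J = n - 1"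
  then have fin: "finite J" by (auto intro: finite_subset)
  obtain f where f: "f \<in> carrier_vec n"
    "\<And>v. v \<notin> J \<Longrightarrow> (-1) ^ card {j \<in> J. j < v} * fan_det n (moment_vec n) (insert v J) = f \<bullet> moment_vec n v"
    "\<And>j. j \<in> J \<Longrightarrow> f \<bullet> moment_vec n j = 0"
    using fan_det_insert[of n J "moment_vec n"] n_pos fin J by auto
  have "chain_boundary m (fan_chain n weight (moment_vec n)) J =
    (\<Sum>v\<in>{1..m} - J. (f \<bullet> moment_vec n v) * L (sqf J + Poly_Mapping.single v 1))"
    unfolding chain_boundary_def
  proof (rule sum.cong[OF refl])
    fix v assume "v \<in> {1..m} - J"
    then have v: "v \<notin> J" by simp
    have "fan_chain n weight (moment_vec n) (insert v J) =
      fan_det n (moment_vec n) (insert v J) * L (sqf J + Poly_Mapping.single v 1)"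
      unfolding fan_chain_def weight_def sqf_insert[OF fin v]
      by (simp add: mult.assoc[symmetric] sgn_mult_abs)
    then show "(-1) ^ card {j \<in> J. j < v} * fan_chain n weight (moment_vec n) (insert v J) =
      (f \<bullet> moment_vec n v) * L (sqf J + Poly_Mapping.single v 1)"
      using f(2)[OF v] by (simp add: mult.assoc[symmetric])
  qed
  also have "\<dots> = (\<Sum>v=1..m. (f \<bullet> moment_vec n v) * L (sqf J + Poly_Mapping.single v 1))"
    using f(3) by (intro sum.mono_neutral_left) auto
  also have "\<dots> = 0" by (rule relation_vec)
  finally show "chain_boundary m (fan_chain n weight (moment_vec n)) J = 0" .
qed (use n_pos in auto)

section \<open>The integral of the multi-fan\<close>

definition dual_form :: "nat set \<Rightarrow> nat \<Rightarrow> mpoly" where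
  "dual_form I i = (if i \<in> I then linear_form n (dual_vec n (moment_vec n) I i) else 0)"

lemma fan_iota_eq: "fan_iota n (moment_vec n) I = msubst mconst (dual_form I)"
  by (simp add: fan_iota_def dual_form_def[abs_def])

lemma dual_form_nonzero:
  assumes "I \<in> simplices" "i \<in> I"
  shows "dual_form I i \<noteq> 0"
proof -
  note I = simplices_D(1,2)[OF assms(1)] assms(2)
  have "dual_vec n (moment_vec n) I i \<noteq> 0\<^sub>v n"
    using dual_vec_moment_prod[OF I I(3)] by auto
  then show ?thesis
    using assms(2) by (simp add: dual_form_def linear_form_eq_0_iff dual_vec_moment_carrier[OF I])
qed

text \<open>The factor of the cone \<open>I\<close> in the integral, after the volume in
  \<open>weight\<close> has been cancelled with the one in the denominator.\<close>

definition cone_coeff :: "nat set \<Rightarrow> mpoly fract" where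
  "cone_coeff I = to_fract (mconst (L (sqf I))) / to_fract (\<Prod>i\<in>I. dual_form I i)"

text \<open>A rational function, not yet known to be constant, and defined in every degree, since
  the induction in \<open>monomial_integral_eq\<close> passes through degrees below
  \<open>n\<close>.\<close>

definition monomial_integral :: "(nat \<Rightarrow>\<^sub>0 nat) \<Rightarrow> mpoly fract" where
  "monomial_integral \<alpha> = (\<Sum>I\<in>simplices. cone_coeff I * to_fract (mpow (dual_form I) \<alpha>))"

text \<open>Expansion of \<open>v\<close> in the dual basis of \<open>I\<close>. The point is that
  the result is the same for all cones, so it can be taken out of a sum over cones.\<close>

lemma sum_dual_form:
  assumes I: "I \<in> simplices" and v: "v \<in> carrier_vec n"
  shows "(\<Sum>j=1..m. mconst (v \<bullet> moment_vec n j) * dual_form I j) = linear_form n v"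
proof -
  note I' = simplices_D[OF I]
  let ?d = "dual_vec n (moment_vec n) I"
  have "(\<Sum>j=1..m. mconst (v \<bullet> moment_vec n j) * dual_form I j) =
      (\<Sum>j\<in>I. mconst (v \<bullet> moment_vec n j) * linear_form n (?d j))"
    using I' by (intro sum.mono_neutral_cong_right) (auto simp: dual_form_def)
  also have "\<dots> = (\<Sum>k<n. mconst (\<Sum>j\<in>I. (v \<bullet> moment_vec n j) * ?d j $ k) * mvar k)"
    unfolding linear_form_def sum_distrib_left mconst_sum sum_distrib_right mconst_mult
    by (subst sum.swap) (simp add: mult.assoc)
  also have "\<dots> = linear_form n v"
    unfolding linear_form_def
    by (intro sum.cong refl) (use dual_vec_moment_expansion[OF I'(1,2) v] in simp)
  finally show ?thesis .
qed

text \<open>The counterpart of \<open>relation_vec\<close>; its right-hand side vanishes as soon as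
  the integral at \<open>\<alpha>\<close> is known to be zero.\<close>

lemma monomial_integral_relation:
  assumes v: "v \<in> carrier_vec n"
  shows "(\<Sum>j=1..m. to_fract (mconst (v \<bullet> moment_vec n j)) *
      monomial_integral (\<alpha> + Poly_Mapping.single j 1)) =
    to_fract (linear_form n v) * monomial_integral \<alpha>"
proof -
  have "(\<Sum>j=1..m. to_fract (mconst (v \<bullet> moment_vec n j)) *
      monomial_integral (\<alpha> + Poly_Mapping.single j 1)) =
    (\<Sum>I\<in>simplices. cone_coeff I * to_fract (mpow (dual_form I) \<alpha>) *
      to_fract (\<Sum>j=1..m. mconst (v \<bullet> moment_vec n j) * dual_form I j))"
    unfolding monomial_integral_def sum_distrib_left
    by (subst sum.swap) (simp add: sum_distrib_left mpow_add mult_ac)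
  also have "\<dots> = (\<Sum>I\<in>simplices. cone_coeff I * to_fract (mpow (dual_form I) \<alpha>) *
      to_fract (linear_form n v))"
    by (intro sum.cong refl) (simp only: sum_dual_form[OF _ v])
  also have "\<dots> = to_fract (linear_form n v) * monomial_integral \<alpha>"
    unfolding monomial_integral_def sum_distrib_left by (simp add: mult_ac)
  finally show ?thesis .
qed

text \<open>A cone \<open>I\<close> other than \<open>S\<close> misses an element of
  \<open>S\<close>, having equally many elements, and so contributes 0; for \<open>I = S\<close>
  numerator and denominator cancel.\<close>

lemma monomial_integral_sqf:
  assumes S: "S \<in> simplices"
  shows "monomial_integral (sqf S) = to_fract (mconst (L (sqf S)))"
proof -
  note S' = simplices_D[OF S]
  have "cone_coeff I * to_fract (mpow (dual_form I) (sqf S)) =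
    (if I = S then to_fract (mconst (L (sqf S))) else 0)" if I: "I \<in> simplices" for I
  proof (cases "I = S")
    case True
    have "(\<Prod>i\<in>S. dual_form S i) \<noteq> 0"
      using dual_form_nonzero[OF S] S' by simp
    then show ?thesis using True S' by (simp add: cone_coeff_def mpow_sqf)
  next
    case False
    then have "\<not> S \<subseteq> I"
      using S' simplices_D[OF I] card_subset_eq[of I S] by auto
    then obtain i where "i \<in> S" "i \<notin> I" by blast
    then have "mpow (dual_form I) (sqf S) = 0"
      using S' by (auto simp: mpow_sqf dual_form_def intro!: prod_zero)
    then show ?thesis using False by simp
  qed
  then have "monomial_integral (sqf S) =
    (\<Sum>I\<in>simplices. if I = S then to_fract (mconst (L (sqf S))) else 0)"
    unfolding monomial_integral_def by (intro sum.cong) auto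
  then show ?thesis using S finite_simplices by simp
qed

text \<open>Downward induction on the size of the support, starting at square-free monomials: as long as the
  support \<open>S\<close> has fewer than \<open>n\<close> elements, a linear relation whose coefficients vanish on \<open>S\<close>
  (respectively on all of \<open>S\<close> but one element) expresses the value at a monomial through
  values at monomials with larger support.\<close>

theorem monomial_integral_eq:
  assumes "Poly_Mapping.keys \<alpha> \<subseteq> {1..m}" "mdeg \<alpha> \<le> n"
  shows "monomial_integral \<alpha> = to_fract (mconst (L \<alpha>))"
  using assms
proof (induction "n - card (Poly_Mapping.keys \<alpha>)" arbitrary: \<alpha> rule: less_induct)
  case less
  define S where "S = Poly_Mapping.keys \<alpha>"
  have S: "finite S" "S \<subseteq> {1..m}" "card S \<le> mdeg \<alpha>"
    using less.prems card_keys_le_mdeg by (auto simp: S_def)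
  show ?case
  proof (cases "card S = n")
    case True
    then have "\<alpha> = sqf S"
      using less.prems S unfolding S_def by (intro mdeg_le_card_keys_imp_sqf) simp
    moreover have "S \<in> simplices" using True S by (simp add: simplices_def)
    ultimately show ?thesis using monomial_integral_sqf by simp
  next
    case False
    then have card_S: "card S < n" using S less.prems by simp
    obtain I where I: "S \<subseteq> I" "I \<subseteq> {1..m}" "card I = n"
      using exists_subset_between[of S n "{1..m}"] S card_S n_le_m by auto
    then have I': "I \<in> simplices" by (simp add: simplices_def)
    have fin: "finite I" using I by (auto intro: finite_subset)
    let ?d = "dual_vec n (moment_vec n) I"
    \<comment> \<open>The error, to be shown zero at \<open>\<alpha>\<close>. Since the relations of
      \<open>L\<close> have right-hand side 0, the errors satisfy the relation of
      \<open>monomial_integral\<close>.\<close>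
    define E where "E \<gamma> = monomial_integral \<gamma> - to_fract (mconst (L \<gamma>))" for \<gamma>
    have E_sum: "(\<Sum>j=1..m. to_fract (mconst (v \<bullet> moment_vec n j)) * E (\<gamma> + Poly_Mapping.single j 1)) =
        to_fract (linear_form n v) * monomial_integral \<gamma>" if v: "v \<in> carrier_vec n" for v \<gamma>
    proof -
      have "(\<Sum>j=1..m. to_fract (mconst (v \<bullet> moment_vec n j)) * to_fract (mconst (L (\<gamma> + Poly_Mapping.single j 1)))) =
        to_fract (mconst (\<Sum>j=1..m. (v \<bullet> moment_vec n j) * L (\<gamma> + Poly_Mapping.single j 1)))"
        by (simp add: mconst_sum mconst_mult)
      also have "\<dots> = 0" by (simp only: relation_vec) simp
      finally show ?thesis
        unfolding E_def right_diff_distrib sum_subtractf monomial_integral_relation[OF v] by simp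
    qed
    have E_larger: "E (\<gamma> + Poly_Mapping.single j 1) = 0"
      if "Poly_Mapping.keys \<gamma> = S" "mdeg \<gamma> < n" "j \<in> {1..m}" "j \<notin> S" for \<gamma> j
    proof -
      have keys: "Poly_Mapping.keys (\<gamma> + Poly_Mapping.single j 1) = insert j S"
        using that by (simp add: keys_add_nat)
      have "monomial_integral (\<gamma> + Poly_Mapping.single j 1) = to_fract (mconst (L (\<gamma> + Poly_Mapping.single j 1)))"
        using that S card_S keys
        by (intro less.hyps) (simp_all add: mdeg_add S_def[symmetric])
      then show ?thesis by (simp add: E_def)
    qed
    have zero: "monomial_integral \<gamma> = 0" if \<gamma>: "Poly_Mapping.keys \<gamma> = S" "mdeg \<gamma> < n" for \<gamma>
    proof -
      \<comment> \<open>The dual vector of an \<open>i\<close> outside \<open>S\<close> vanishes on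
        \<open>S\<close>, and at \<open>j\<close> outside \<open>S\<close> the error is zero by
        induction. What remains is a nonzero linear form times the integral, in a field.\<close>
      obtain i where i: "i \<in> I" "i \<notin> S"
        using card_S I card_mono[OF S(1), of I] by (metis leD subsetI)
      note d = dual_vec_moment_carrier[OF fin I(3) i(1)]
      have "to_fract (mconst (?d i \<bullet> moment_vec n j)) * E (\<gamma> + Poly_Mapping.single j 1) = 0"
        if j: "j \<in> {1..m}" for j
      proof (cases "j \<in> S")
        case True
        then have "?d i \<bullet> moment_vec n j = 0"
          using dual_vec_moment_prod[OF fin I(3) i(1), of j] I i by auto
        then show ?thesis by simp
      qed (use E_larger[OF \<gamma> j] in simp)
      then have "to_fract (linear_form n (?d i)) * monomial_integral \<gamma> = 0"
        unfolding E_sum[OF d, symmetric] by (intro sum.neutral) blast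
      moreover have "linear_form n (?d i) \<noteq> 0"
        using dual_form_nonzero[OF I' i(1)] i by (simp add: dual_form_def)
      ultimately show ?thesis by simp
    qed
    show ?thesis
    proof (cases "mdeg \<alpha> < n")
      case True
      moreover have "L \<alpha> = 0" using support[of \<alpha>] True by force
      ultimately show ?thesis using zero[of \<alpha>] by (simp add: S_def)
    next
      case False
      then have deg: "mdeg \<alpha> = n" using less.prems by simp
      \<comment> \<open>The degree exceeds the size of \<open>S\<close>, so some exponent is at
        least 2, and lowering it by one keeps the support.\<close>
      obtain i where i: "i \<in> S" "Poly_Mapping.lookup \<alpha> i \<noteq> 1"
      proof (rule ccontr)
        assume "\<not> thesis"
        then have "mdeg \<alpha> = (\<Sum>i\<in>S. 1)"
          unfolding mdeg_def S_def using that by (intro sum.cong refl) (auto simp: S_def)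
        then show False using deg card_S by simp
      qed
      define \<gamma> where "\<gamma> = \<alpha> - Poly_Mapping.single i 1"
      have \<alpha>: "\<alpha> = \<gamma> + Poly_Mapping.single i 1"
        unfolding \<gamma>_def using i
        by (intro poly_mapping_eqI) (auto simp: S_def lookup_add lookup_minus lookup_single when_def in_keys_iff)
      have "i \<in> Poly_Mapping.keys \<gamma>"
        using i by (auto simp: \<alpha> lookup_add in_keys_iff)
      then have \<gamma>: "Poly_Mapping.keys \<gamma> = S" "mdeg \<gamma> < n"
        using deg unfolding S_def \<alpha> by (auto simp: keys_add_nat mdeg_add)
      have i': "i \<in> I" using i I by blast
      \<comment> \<open>For \<open>i\<close> in \<open>S\<close> the dual vector is 1 at
        \<open>i\<close> and 0 on the rest of \<open>S\<close>, so the relation at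
        \<open>\<gamma>\<close> isolates the error at \<open>\<alpha>\<close>.\<close>
      note d = dual_vec_moment_carrier[OF fin I(3) i']
      have "to_fract (mconst (?d i \<bullet> moment_vec n j)) * E (\<gamma> + Poly_Mapping.single j 1) =
         (if j = i then E \<alpha> else 0)" if j: "j \<in> {1..m}" for j
      proof (cases "j \<in> S")
        case True
        then have "?d i \<bullet> moment_vec n j = (if j = i then 1 else 0)"
          using dual_vec_moment_prod[OF fin I(3) i', of j] I by auto
        then show ?thesis by (simp add: \<alpha>)
      qed (use E_larger[OF \<gamma> j] i in auto)
      then have "(\<Sum>j=1..m. to_fract (mconst (?d i \<bullet> moment_vec n j)) * E (\<gamma> + Poly_Mapping.single j 1)) =
        (\<Sum>j=1..m. if j = i then E \<alpha> else 0)"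
        by (intro sum.cong refl) blast
      also have "\<dots> = E \<alpha>" using i S by auto
      finally have "E \<alpha> = 0" using E_sum[OF d, of \<gamma>] zero[OF \<gamma>] by simp
      then show ?thesis by (simp add: E_def)
    qed
  qed
qed

text \<open>Expanding \<open>x\<close> into monomials and exchanging the sums leaves a combination
  of constants by \<open>monomial_integral_eq\<close>. The number in the definite description is
  unique because the reals embed into the fraction field.\<close>

theorem fan_integral_weight:
  assumes x: "x \<in> mpolys_in {1..m}" and deg: "\<And>\<alpha>. \<alpha> \<in> Poly_Mapping.keys x \<Longrightarrow> mdeg \<alpha> \<le> n"
  shows "fan_integral n m weight (moment_vec n) x =
    (\<Sum>\<alpha>\<in>Poly_Mapping.keys x. Poly_Mapping.lookup x \<alpha> * L \<alpha>)"
proof -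
  have cone: "Fract (mconst (weight I) * fan_iota n (moment_vec n) I x)
      (mconst \<bar>fan_det n (moment_vec n) I\<bar> * (\<Prod>i\<in>I. fan_iota n (moment_vec n) I (mvar i))) =
    cone_coeff I * to_fract (fan_iota n (moment_vec n) I x)" if I: "I \<in> simplices" for I
  proof -
    have "to_fract (mconst \<bar>fan_det n (moment_vec n) I\<bar>) \<noteq> 0"
      using fan_det_moment_nonzero[OF simplices_D(1,2)[OF I]]
      by (simp add: mconst_eq_0_iff)
    then show ?thesis
      unfolding Fract_conv_to_fract fan_iota_eq cone_coeff_def weight_def mconst_mult to_fract_mult
      by (simp add: real_ring_hom.msubst_mvar[OF real_ring_hom_mconst])
  qed
  have "(\<Sum>I\<in>fan_cones n m weight. Fract (mconst (weight I) * fan_iota n (moment_vec n) I x)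
      (mconst \<bar>fan_det n (moment_vec n) I\<bar> * (\<Prod>i\<in>I. fan_iota n (moment_vec n) I (mvar i)))) =
    (\<Sum>I\<in>simplices. Fract (mconst (weight I) * fan_iota n (moment_vec n) I x)
      (mconst \<bar>fan_det n (moment_vec n) I\<bar> * (\<Prod>i\<in>I. fan_iota n (moment_vec n) I (mvar i))))"
    using finite_simplices
    by (intro sum.mono_neutral_left) (auto simp: fan_cones_def simplices_def fract_collapse)
  also have "\<dots> = (\<Sum>I\<in>simplices. cone_coeff I * to_fract (fan_iota n (moment_vec n) I x))"
    by (intro sum.cong refl cone)
  also have "\<dots> = (\<Sum>\<alpha>\<in>Poly_Mapping.keys x. to_fract (mconst (Poly_Mapping.lookup x \<alpha>)) * monomial_integral \<alpha>)"
    unfolding fan_iota_eq msubst_eq monomial_integral_def sum_distrib_left to_fract_sum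
    by (subst sum.swap) (simp add: mult_ac)
  also have "\<dots> = (\<Sum>\<alpha>\<in>Poly_Mapping.keys x. to_fract (mconst (Poly_Mapping.lookup x \<alpha> * L \<alpha>)))"
    using x deg by (intro sum.cong refl) (auto simp: monomial_integral_eq mpolys_in_def mconst_mult)
  also have "\<dots> = to_fract (mconst (\<Sum>\<alpha>\<in>Poly_Mapping.keys x. Poly_Mapping.lookup x \<alpha> * L \<alpha>))"
    by (simp add: mconst_sum)
  finally show ?thesis
    unfolding fan_integral_def to_fract_def[symmetric] by (intro the_equality) auto
qed

section \<open>The volume polynomial\<close>

text \<open>All these monomials occur in the \<open>n\<close>-th power of the sum of the variables,
  as multinomial coefficients are nonzero.\<close>

lemma finite_exponents: "finite {\<alpha>. Poly_Mapping.keys \<alpha> \<subseteq> {1..m} \<and> mdeg \<alpha> = n}"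
proof (rule finite_subset)
  show "{\<alpha>. Poly_Mapping.keys \<alpha> \<subseteq> {1..m} \<and> mdeg \<alpha> = n} \<subseteq>
    Poly_Mapping.keys ((\<Sum>i=1..m. mconst 1 * mvar i) ^ n)"
    unfolding in_keys_iff subset_iff lookup_linear_power[OF finite_atLeastAtMost]
    by (simp add: mpow_def)
qed simp

text \<open>The factor \<open>1 / fact n\<close> cancels against the multinomial coefficients, so
  the volume polynomial has the coefficients \<open>L \<alpha> / mfact \<alpha>\<close>, and
  \<open>dcoeff\<close> removes the factorial.\<close>

theorem dcoeff_volume_polynomial:
  "dcoeff (volume_polynomial n m weight (moment_vec n)) \<alpha> =
    (if Poly_Mapping.keys \<alpha> \<subseteq> {1..m} then L \<alpha> else 0)"
proof -
  let ?K = "{\<alpha>. Poly_Mapping.keys \<alpha> \<subseteq> {1..m} \<and> mdeg \<alpha> = n}"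
  define P where "P = (\<Sum>\<alpha>\<in>?K. Poly_Mapping.single \<alpha> (L \<alpha> / mfact \<alpha>))"
  have lookup_P: "Poly_Mapping.lookup P \<alpha> = (if \<alpha> \<in> ?K then L \<alpha> / mfact \<alpha> else 0)" for \<alpha>
    using finite_exponents by (simp add: P_def lookup_sum lookup_single when_def)
  have keys_P: "Poly_Mapping.keys P \<subseteq> ?K"
    unfolding subset_iff in_keys_iff[of _ P] lookup_P by simp
  have P_in: "P \<in> mpolys_in {1..m}" using keys_P by (auto simp: mpolys_in_def)
  have val: "msubst (\<lambda>r. r) c P =
      1 / fact n * fan_integral n m weight (moment_vec n) ((\<Sum>i=1..m. mconst (c i) * mvar i) ^ n)" for c
  proof -
    let ?y = "\<Sum>i=1..m. mconst (c i) * mvar i"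
    have lookup_y: "Poly_Mapping.lookup (?y ^ n) \<alpha> =
        (if \<alpha> \<in> ?K then fact n * mpow c \<alpha> / mfact \<alpha> else 0)" for \<alpha>
      by (simp add: lookup_linear_power)
    have keys_y: "Poly_Mapping.keys (?y ^ n) \<subseteq> ?K"
      unfolding subset_iff in_keys_iff lookup_y by auto
    have "fan_integral n m weight (moment_vec n) (?y ^ n) =
      (\<Sum>\<alpha>\<in>Poly_Mapping.keys (?y ^ n). Poly_Mapping.lookup (?y ^ n) \<alpha> * L \<alpha>)"
      using keys_y by (intro fan_integral_weight) (auto simp: mpolys_in_def)
    also have "\<dots> = (\<Sum>\<alpha>\<in>?K. Poly_Mapping.lookup (?y ^ n) \<alpha> * L \<alpha>)"
      using keys_y finite_exponents by (intro sum.mono_neutral_left) (auto simp: in_keys_iff)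
    also have "\<dots> = fact n * (\<Sum>\<alpha>\<in>?K. L \<alpha> / mfact \<alpha> * mpow c \<alpha>)"
      unfolding lookup_y sum_distrib_left by (intro sum.cong refl) simp
    also have "(\<Sum>\<alpha>\<in>?K. L \<alpha> / mfact \<alpha> * mpow c \<alpha>) =
        (\<Sum>\<alpha>\<in>?K. Poly_Mapping.lookup P \<alpha> * mpow c \<alpha>)"
      by (intro sum.cong refl) (simp add: lookup_P)
    also have "\<dots> = msubst (\<lambda>r. r) c P"
      unfolding msubst_eq using keys_P finite_exponents
      by (intro sum.mono_neutral_right) (simp_all add: in_keys_iff)
    finally show ?thesis by simp
  qed
  have "volume_polynomial n m weight (moment_vec n) = P"
    unfolding volume_polynomial_def
  proof (rule the_equality)
    show "P \<in> mpolys_in {1..m} \<and> (\<forall>c. msubst (\<lambda>r. r) c P =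
      1 / fact n * fan_integral n m weight (moment_vec n) ((\<Sum>i=1..m. mconst (c i) * mvar i) ^ n))"
      using P_in val by blast
    fix Q assume "Q \<in> mpolys_in {1..m} \<and> (\<forall>c. msubst (\<lambda>r. r) c Q =
      1 / fact n * fan_integral n m weight (moment_vec n) ((\<Sum>i=1..m. mconst (c i) * mvar i) ^ n))"
    then show "Q = P"
      using P_in val by (intro mpoly_eqI_values[of "{1..m}"]) auto
  qed
  then show ?thesis
    using support[of \<alpha>] by (auto simp: dcoeff_def lookup_P)
qed

end

section \<open>Poincare duality algebras\<close>

context poincare_duality_algebra
begin

definition comp :: "'a \<Rightarrow> nat \<Rightarrow> 'a" where
  "comp a = (THE f. (\<forall>j. f j \<in> A j) \<and> a = (\<Sum>j\<le>n. f j))"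

lemma comp_in [simp]: "comp a j \<in> A j"
  and sum_comp: "(\<Sum>j\<le>n. comp a j) = a"
  using theI'[OF direct_sum[of a]] by (simp_all add: comp_def)

lemma comp_unique:
  assumes "\<And>j. f j \<in> A j" "a = (\<Sum>j\<le>n. f j)"
  shows "comp a = f"
  unfolding comp_def using assms by (intro the1_equality direct_sum) auto

lemma zero_in [simp]: "0 \<in> A j"
  and add_in: "a \<in> A j \<Longrightarrow> b \<in> A j \<Longrightarrow> a + b \<in> A j"
  and scale_in: "a \<in> A j \<Longrightarrow> r *\<^sub>R a \<in> A j"
  using component_subspace[of j]
  by (auto simp: real_vector.subspace_0 real_vector.subspace_add real_vector.subspace_scale)

lemma sum_in: "(\<And>i. i \<in> S \<Longrightarrow> f i \<in> A j) \<Longrightarrow> sum f S \<in> A j"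
  using component_subspace[of j] by (rule real_vector.subspace_sum)

lemma comp_add: "comp (a + b) j = comp a j + comp b j"
  by (subst comp_unique[of "\<lambda>j. comp a j + comp b j"]) (auto simp: add_in sum.distrib sum_comp)

lemma comp_scale: "comp (r *\<^sub>R a) j = r *\<^sub>R comp a j"
  by (subst comp_unique[of "\<lambda>j. r *\<^sub>R comp a j"])
    (auto simp: scale_in sum_comp simp flip: scaleR_sum_right)

lemma comp_component:
  assumes "a \<in> A i"
  shows "comp a j = (if j = i then a else 0)"
proof -
  have "a = 0" if "i > n" using assms component_trivial[OF that] by simp
  then show ?thesis
    using assms by (subst comp_unique[of "\<lambda>j. if j = i then a else 0"]) (auto simp: not_le)
qed

lemma comp_zero [simp]: "comp 0 j = 0"
  using comp_component[of 0 j] by simp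

lemma comp_sum: "comp (sum f S) j = (\<Sum>i\<in>S. comp (f i) j)"
  by (induction S rule: infinite_finite_induct) (auto simp: comp_add)

text \<open>Extends \<open>intg\<close> by zero on the lower components, so that the pairing is
  defined on the whole algebra at once.\<close>

definition integral :: "'a \<Rightarrow> real" where
  "integral a = intg (comp a n)"

lemma integral_add: "integral (a + b) = integral a + integral b"
  by (simp add: integral_def comp_add intg_add)

lemma integral_scale: "integral (r *\<^sub>R a) = r * integral a"
  by (simp add: integral_def comp_scale intg_scale)

lemma integral_zero [simp]: "integral 0 = 0"
  using integral_scale[of 0 0] by simp

lemma integral_sum: "integral (sum f S) = (\<Sum>i\<in>S. integral (f i))"
  by (induction S rule: infinite_finite_induct) (auto simp: integral_add)

lemma integral_component: "a \<in> A i \<Longrightarrow> integral a = (if i = n then intg a else 0)"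
  using integral_zero by (auto simp: integral_def comp_component)

text \<open>Against \<open>b\<close> of degree \<open>n - p\<close> only the component of
  \<open>a\<close> in degree \<open>p\<close> reaches the top degree, so
  \<open>nondegenerate_left\<close> applies to each component.\<close>

lemma integral_nondegenerate:
  assumes "\<And>b. integral (a * b) = 0"
  shows "a = 0"
proof -
  have "comp a p = 0" if p: "p \<le> n" for p
  proof (rule nondegenerate_left[OF p comp_in])
    fix b assume b: "b \<in> A (n - p)"
    have "a * b = (\<Sum>j\<le>n. comp a j * b)"
      by (simp add: sum_comp flip: sum_distrib_right)
    then have "0 = (\<Sum>j\<le>n. integral (comp a j * b))"
      using assms[of b] by (simp add: integral_sum)
    also have "\<dots> = (\<Sum>j\<le>n. if j = p then intg (comp a p * b) else 0)"
      using integral_component[OF mult_component[OF comp_in b]] p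
      by (intro sum.cong refl) auto
    also have "\<dots> = intg (comp a p * b)" using p by simp
    finally show "intg (comp a p * b) = 0" by simp
  qed
  then show "a = 0" using sum_comp[of a] by simp
qed

lemma power_in: "a \<in> A 1 \<Longrightarrow> a ^ k \<in> A k"
proof (induction k)
  case (Suc k)
  then show ?case using mult_component[of a 1 "a ^ k" k] by simp
qed (simp add: one_component)

lemma mpow_in:
  assumes "\<And>i. x i \<in> A 1"
  shows "mpow x \<alpha> \<in> A (mdeg \<alpha>)"
proof -
  have "finite S \<Longrightarrow> (\<Prod>i\<in>S. x i ^ e i) \<in> A (\<Sum>i\<in>S. e i)" for S and e :: "nat \<Rightarrow> nat"
    by (induction S rule: finite_induct) (simp_all add: one_component mult_component power_in[OF assms])
  then show ?thesis by (simp add: mpow_def mdeg_def)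
qed

end

section \<open>Rings given by a carrier set\<close>

lemma cring_subring:
  fixes S :: "'a::comm_ring_1 set"
  assumes "0 \<in> S" "1 \<in> S" "\<And>a b. a \<in> S \<Longrightarrow> b \<in> S \<Longrightarrow> a + b \<in> S"
    "\<And>a b. a \<in> S \<Longrightarrow> b \<in> S \<Longrightarrow> a * b \<in> S" "\<And>a. a \<in> S \<Longrightarrow> - a \<in> S"
  shows "cring \<lparr>carrier = S, mult = (*), one = 1, zero = 0, add = (+)\<rparr>"
proof (intro cringI abelian_groupI comm_monoidI)
  fix a assume "a \<in> carrier \<lparr>carrier = S, mult = (*), one = 1, zero = 0, add = (+)\<rparr>"
  then show "\<exists>b\<in>carrier \<lparr>carrier = S, mult = (*), one = 1, zero = 0, add = (+)\<rparr>.
      b \<oplus>\<^bsub>\<lparr>carrier = S, mult = (*), one = 1, zero = 0, add = (+)\<rparr>\<^esub> a =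
      \<zero>\<^bsub>\<lparr>carrier = S, mult = (*), one = 1, zero = 0, add = (+)\<rparr>\<^esub>"
    using assms(5) by (intro bexI[of _ "- a"]) auto
qed (use assms in \<open>auto simp: algebra_simps\<close>)

lemma cring_diff_ops: "cring (diff_ops m)"
  unfolding diff_ops_def by (intro cring_subring mpolys_in_ring)

lemma cring_class_ring: "cring (class_ring :: 'a::comm_ring_1 ring)"
  by (intro cring_subring) auto

section \<open>Evaluation of differential operators in the algebra\<close>

locale generated_poincare_duality_algebra = poincare_duality_algebra n A intg
  for n and A :: "nat \<Rightarrow> 'a::{comm_ring_1,real_algebra_1} set" and intg +
  fixes m :: nat and x :: "nat \<Rightarrow> 'a"
  assumes n_pos: "n \<ge> 1" and n_le_m: "n \<le> m"
    and generated: "generated_in_degree_two A"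
    and x_in: "x i \<in> A 1"
    and x_span: "A 1 \<subseteq> real_vector.span (x ` {1..m})"
    and x_relation: "k < n \<Longrightarrow> (\<Sum>j=1..m. real j ^ k *\<^sub>R x j) = 0"
begin

definition monomial_value :: "(nat \<Rightarrow>\<^sub>0 nat) \<Rightarrow> real" where
  "monomial_value \<alpha> = integral (mpow x \<alpha>)"

text \<open>The degree condition holds since \<open>integral\<close> vanishes on the components
  other than \<open>A n\<close>; the sum in \<open>relation\<close> is the integral of
  \<open>mpow x \<alpha>\<close> times the zero element from \<open>x_relation\<close>.\<close>

sublocale moment_functional n m monomial_value
proof
  show "mdeg \<alpha> = n" if "monomial_value \<alpha> \<noteq> 0" for \<alpha>
    using that integral_component[OF mpow_in[of x \<alpha>]] x_in
    by (auto simp: monomial_value_def split: if_splits)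
  show "(\<Sum>j=1..m. real j ^ k * monomial_value (\<alpha> + Poly_Mapping.single j 1)) = 0" if "k < n" for k \<alpha>
  proof -
    have "(\<Sum>j=1..m. real j ^ k * monomial_value (\<alpha> + Poly_Mapping.single j 1)) =
      integral (mpow x \<alpha> * (\<Sum>j=1..m. real j ^ k *\<^sub>R x j))"
      by (simp add: monomial_value_def mpow_add sum_distrib_left integral_sum integral_scale)
    then show ?thesis by (simp only: x_relation[OF that]) simp
  qed
qed (use n_pos n_le_m in auto)

definition eval :: "mpoly \<Rightarrow> 'a" where
  "eval = msubst of_real x"

sublocale eval: real_ring_hom "of_real :: real \<Rightarrow> 'a"
  by (rule real_ring_hom_of_real)

lemma eval_eq_sum: "eval D = (\<Sum>\<alpha>\<in>Poly_Mapping.keys D. Poly_Mapping.lookup D \<alpha> *\<^sub>R mpow x \<alpha>)"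
  by (simp add: eval_def msubst_eq scaleR_conv_of_real)

lemma integral_eval_mult_mpow:
  "integral (eval D * mpow x \<beta>) =
    (\<Sum>\<alpha>\<in>Poly_Mapping.keys D. Poly_Mapping.lookup D \<alpha> * monomial_value (\<alpha> + \<beta>))"
  by (simp add: eval_eq_sum sum_distrib_right integral_sum integral_scale monomial_value_def mpow_add)

text \<open>The image is a unital subalgebra containing the \<open>x i\<close>, hence all of
  \<open>A 1\<close>, which generates the algebra.\<close>

lemma eval_surj: "eval ` mpolys_in {1..m} = UNIV"
proof -
  let ?C = "eval ` mpolys_in {1..m}"
  have scale: "r *\<^sub>R eval p = eval (mconst r * p)" for r p
    by (simp add: eval_def scaleR_conv_of_real)
  have sub: "real_vector.subspace ?C"
  proof (rule real_vector.subspaceI)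
    show "0 \<in> ?C" by (rule image_eqI[of _ _ 0]) (simp_all add: eval_def mpolys_in_zero)
    show "a + b \<in> ?C" if ab: "a \<in> ?C" "b \<in> ?C" for a b
    proof -
      obtain p q where "p \<in> mpolys_in {1..m}" "q \<in> mpolys_in {1..m}" "a = eval p" "b = eval q"
        using ab by blast
      then show ?thesis by (intro image_eqI[of _ _ "p + q"]) (simp_all add: eval_def mpolys_in_add)
    qed
    show "r *\<^sub>R a \<in> ?C" if a: "a \<in> ?C" for r a
      using a by (auto simp: scale intro!: imageI mpolys_in_mult mpolys_in_mconst)
  qed
  have "unital_subalgebra ?C"
    unfolding unital_subalgebra_def
  proof (intro conjI ballI sub)
    show "1 \<in> ?C" by (rule image_eqI[of _ _ 1]) (simp_all add: eval_def mpolys_in_one)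
    fix a b assume ab: "a \<in> ?C" "b \<in> ?C"
    obtain p q where "p \<in> mpolys_in {1..m}" "q \<in> mpolys_in {1..m}" "a = eval p" "b = eval q"
      using ab by blast
    then show "a * b \<in> ?C" by (intro image_eqI[of _ _ "p * q"]) (simp_all add: eval_def mpolys_in_mult)
  qed
  moreover have "x ` {1..m} \<subseteq> ?C"
    by (auto intro!: image_eqI[of _ _ "mvar i" for i] mpolys_in_mvar simp: eval_def)
  then have "A 1 \<subseteq> ?C"
    using x_span real_vector.span_minimal[OF _ sub] by blast
  ultimately have "unital_subalgebra hull (A 1) \<subseteq> ?C" by (simp add: hull_minimal)
  then show ?thesis using generated by (auto simp: generated_in_degree_two_def)
qed

lemma eval_homogeneous: "eval ` {D \<in> mpolys_in {1..m}. homogeneous j D} = A j"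
proof (intro equalityI subsetI)
  fix a assume "a \<in> eval ` {D \<in> mpolys_in {1..m}. homogeneous j D}"
  then obtain D where D: "homogeneous j D" "a = eval D" by blast
  have "Poly_Mapping.lookup D \<alpha> *\<^sub>R mpow x \<alpha> \<in> A j" if "\<alpha> \<in> Poly_Mapping.keys D" for \<alpha>
    using that D(1) mpow_in[of x \<alpha>] x_in by (auto simp: homogeneous_def mdeg_def intro: scale_in)
  then show "a \<in> A j" by (simp add: D(2) eval_eq_sum sum_in)
next
  fix a assume a: "a \<in> A j"
  obtain D where D: "D \<in> mpolys_in {1..m}" "a = eval D" using eval_surj by blast
  \<comment> \<open>Taking components commutes with \<open>eval\<close>, so the degree
    \<open>j\<close> part of any preimage of \<open>a\<close> is a preimage as well.\<close>
  let ?K = "{\<alpha> \<in> Poly_Mapping.keys D. mdeg \<alpha> = j}"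
  define D' where "D' = (\<Sum>\<alpha>\<in>?K. Poly_Mapping.single \<alpha> (Poly_Mapping.lookup D \<alpha>))"
  have "Poly_Mapping.keys D' \<subseteq> ?K"
    unfolding D'_def by (rule order.trans[OF keys_sum]) (auto split: if_splits)
  then have "D' \<in> mpolys_in {1..m}" "homogeneous j D'"
    using D(1) by (auto simp: mpolys_in_def homogeneous_def mdeg_def)
  moreover have "eval D' = a"
  proof -
    have "a = comp a j" using a by (simp add: comp_component)
    also have "\<dots> = (\<Sum>\<alpha>\<in>Poly_Mapping.keys D. Poly_Mapping.lookup D \<alpha> *\<^sub>R comp (mpow x \<alpha>) j)"
      by (simp add: D(2) eval_eq_sum comp_sum comp_scale)
    also have "\<dots> = (\<Sum>\<alpha>\<in>Poly_Mapping.keys D. if mdeg \<alpha> = j then Poly_Mapping.lookup D \<alpha> *\<^sub>R mpow x \<alpha> else 0)"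
      using x_in by (intro sum.cong refl) (auto simp: comp_component[OF mpow_in])
    also have "\<dots> = (\<Sum>\<alpha>\<in>?K. Poly_Mapping.lookup D \<alpha> *\<^sub>R mpow x \<alpha>)"
      by (simp add: sum.inter_filter)
    also have "\<dots> = eval D'"
      by (simp add: D'_def eval_def eval.msubst_sum scaleR_conv_of_real)
    finally show ?thesis by simp
  qed
  ultimately show "a \<in> eval ` {D \<in> mpolys_in {1..m}. homogeneous j D}" by blast
qed

text \<open>\<open>D\<close> kills the volume polynomial iff \<open>eval D\<close> is orthogonal to
  all monomials in \<open>x 1, ..., x m\<close>. These span the algebra by \<open>eval_surj\<close>,
  and the pairing is nondegenerate.\<close>

theorem annihilator_volume_polynomial:
  "annihilator m (volume_polynomial n m weight (moment_vec n)) = {D \<in> mpolys_in {1..m}. eval D = 0}"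
proof -
  have "apply_diff D (volume_polynomial n m weight (moment_vec n)) = 0 \<longleftrightarrow> eval D = 0"
    if D: "D \<in> mpolys_in {1..m}" for D
  proof -
    \<comment> \<open>A \<open>\<beta>\<close> with a variable outside \<open>{1..m}\<close> yields
      no condition, because the volume polynomial does not contain that variable.\<close>
    have eq: "(\<Sum>\<alpha>\<in>Poly_Mapping.keys D. Poly_Mapping.lookup D \<alpha> *
        dcoeff (volume_polynomial n m weight (moment_vec n)) (\<alpha> + \<beta>)) =
      (if Poly_Mapping.keys \<beta> \<subseteq> {1..m} then integral (eval D * mpow x \<beta>) else 0)" for \<beta>
      unfolding dcoeff_volume_polynomial integral_eval_mult_mpow
      using D by (auto simp: mpolys_in_def keys_add_nat intro!: sum.cong sum.neutral)
    have "eval D = 0" if *: "\<And>\<beta>. Poly_Mapping.keys \<beta> \<subseteq> {1..m} \<Longrightarrow> integral (eval D * mpow x \<beta>) = 0"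
    proof (rule integral_nondegenerate)
      fix b
      obtain p where p: "p \<in> mpolys_in {1..m}" "b = eval p" using eval_surj by blast
      have "integral (eval D * b) = (\<Sum>\<alpha>\<in>Poly_Mapping.keys p. Poly_Mapping.lookup p \<alpha> * integral (eval D * mpow x \<alpha>))"
        by (simp add: p(2) eval_eq_sum[of p] sum_distrib_left integral_sum integral_scale)
      also have "\<dots> = 0" using p(1) by (intro sum.neutral) (auto simp: mpolys_in_def *)
      finally show "integral (eval D * b) = 0" .
    qed
    then show ?thesis unfolding apply_diff_eq_0_iff eq by auto
  qed
  then show ?thesis by (auto simp: annihilator_def diff_ops_def)
qed

text \<open>First isomorphism theorem for \<open>eval\<close>. Since \<open>\<phi>\<close> inverts
  the induced map, \<open>\<phi> (eval D)\<close> is the class of \<open>D\<close>, and this rule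
  gives both the action of scalars and the grading.\<close>

theorem graded_isomorphic: "graded_isomorphic_to_multi_fan_algebra A n m weight (moment_vec n)"
proof -
  let ?R = "diff_ops m" and ?S = "class_ring :: 'a ring"
  let ?cl = "multi_fan_class n m weight (moment_vec n)"
  have carrier_R: "carrier ?R = mpolys_in {1..m}" by (simp add: diff_ops_def)
  interpret R: cring ?R by (rule cring_diff_ops)
  interpret S: cring ?S by (rule cring_class_ring)
  interpret h: ring_hom_ring ?R ?S eval
    by (rule ring_hom_ringI) (unfold_locales, auto simp: diff_ops_def eval_def)
  have ker: "a_kernel ?R ?S eval = annihilator m (volume_polynomial n m weight (moment_vec n))"
    unfolding a_kernel_def' annihilator_volume_polynomial carrier_R by simp
  have Q: "?R Quot a_kernel ?R ?S eval = multi_fan_algebra n m weight (moment_vec n)"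
    by (simp add: ker multi_fan_algebra_def)
  have cl: "a_kernel ?R ?S eval +>\<^bsub>?R\<^esub> D = ?cl D" for D
    by (simp add: ker multi_fan_class_def)
  \<comment> \<open>\<open>eval\<close> is constant on each coset of its kernel, so the image of a
    coset is a singleton.\<close>
  define \<theta> where "\<theta> = (\<lambda>X. the_elem (eval ` X))"
  have \<theta>: "\<theta> \<in> ring_iso (multi_fan_algebra n m weight (moment_vec n)) ?S"
    unfolding \<theta>_def Q[symmetric] by (rule h.FactRing_iso_set) (simp only: carrier_R eval_surj partial_object.simps)
  define \<phi> where "\<phi> = inv_into (carrier (multi_fan_algebra n m weight (moment_vec n))) \<theta>"
  have ring_Q: "ring (multi_fan_algebra n m weight (moment_vec n))"
    unfolding Q[symmetric] by (rule ideal.quotient_is_ring[OF h.kernel_is_ideal])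
  have \<phi>: "\<phi> \<in> ring_iso ?S (multi_fan_algebra n m weight (moment_vec n))"
    unfolding \<phi>_def by (rule ring_iso_set_sym[OF ring_Q \<theta>])
  have \<phi>_eval: "\<phi> (eval D) = ?cl D" if D: "D \<in> mpolys_in {1..m}" for D
  proof -
    have "\<theta> (?cl D) = eval D"
      unfolding \<theta>_def cl[symmetric] using D by (intro h.the_elem_simp) (simp add: carrier_R)
    moreover have "?cl D \<in> carrier (multi_fan_algebra n m weight (moment_vec n))"
      unfolding Q[symmetric] cl[symmetric] FactRing_def A_RCOSETS_def'
      using D by (auto simp: carrier_R)
    moreover have "inj_on \<theta> (carrier (multi_fan_algebra n m weight (moment_vec n)))"
      using \<theta> by (simp add: ring_iso_def bij_betw_def)
    ultimately show ?thesis by (metis \<phi>_def inv_into_f_f)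
  qed
  show ?thesis
    unfolding graded_isomorphic_to_multi_fan_algebra_def
  proof (intro bexI[OF _ \<phi>] conjI allI)
    fix r and a :: 'a
    have "\<phi> (r *\<^sub>R a) = \<phi> (eval (mconst r) \<otimes>\<^bsub>?S\<^esub> a)"
      by (simp add: eval_def scaleR_conv_of_real)
    also have "\<dots> = \<phi> (eval (mconst r)) \<otimes>\<^bsub>multi_fan_algebra n m weight (moment_vec n)\<^esub> \<phi> a"
      using \<phi> by (intro ring_hom_mult[of \<phi> ?S]) (auto simp: ring_iso_def)
    finally show "\<phi> (r *\<^sub>R a) = ?cl (mconst r) \<otimes>\<^bsub>multi_fan_algebra n m weight (moment_vec n)\<^esub> \<phi> a"
      by (simp add: \<phi>_eval mpolys_in_mconst)
  next
    fix j
    show "\<phi> ` A j = multi_fan_component n m weight (moment_vec n) j"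
      unfolding eval_homogeneous[of j, symmetric] multi_fan_component_def carrier_R image_image
      by (intro image_cong refl) (simp add: \<phi>_eval)
  qed
qed

end

section \<open>Choice of the generators\<close>

text \<open>A spanning set of \<open>A 1\<close> is put at the places \<open>n + 1, \<dots>, m\<close>; the relations then determine
  the elements at the places \<open>1, \<dots>, n\<close>.\<close>

lemma (in poincare_duality_algebra) exists_related_spanning_family:
  assumes n_pos: "n \<ge> 1"
  obtains m and x :: "nat \<Rightarrow> 'a" where "n \<le> m" "\<And>i. x i \<in> A 1"
    "A 1 \<subseteq> real_vector.span (x ` {1..m})"
    "\<And>k. k < n \<Longrightarrow> (\<Sum>j=1..m. real j ^ k *\<^sub>R x j) = 0"
proof -
  obtain B :: "'a set" where B: "finite B" "real_vector.span B = UNIV" using finite_dim by blast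
  obtain bs where bs: "set bs = B" using finite_list[OF B(1)] by blast
  let ?I = "{1..n}" and ?m = "n + length bs"
  let ?d = "dual_vec n (moment_vec n) ?I"
  \<comment> \<open>\<open>Suc n\<close> is the place of the first list entry. Beyond the list the
    entry is unspecified, but \<open>comp\<close> still puts it into \<open>A 1\<close>.\<close>
  define y where "y j = comp (bs ! (j - Suc n)) 1" for j
  \<comment> \<open>If each later moment vector is written in the basis indexed by
    \<open>?I\<close>, the relations demand exactly these values at the places
    \<open>1, ..., n\<close>.\<close>
  define x where "x i = (if i \<in> ?I then - (\<Sum>j=n+1..?m. (?d i \<bullet> moment_vec n j) *\<^sub>R y j)
     else y i)" for i
  have y_in: "y j \<in> A 1" for j by (simp add: y_def)
  show thesis
  proof
    show "n \<le> ?m" by simp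
  next
    show "x i \<in> A 1" for i
    proof (cases "i \<in> ?I")
      case True
      have "(-1) *\<^sub>R (\<Sum>j=n+1..?m. (?d i \<bullet> moment_vec n j) *\<^sub>R y j) \<in> A 1"
        by (intro scale_in sum_in y_in)
      then show ?thesis using True by (simp add: x_def)
    qed (simp only: x_def if_False y_in)
  next
    let ?T = "real_vector.span (x ` {1..?m})"
    \<comment> \<open>The members of \<open>B\<close> need not be homogeneous, so the claim is
      extended linearly to the components \<open>comp a 1\<close> of all \<open>a\<close> and only
      then restricted to \<open>A 1\<close>.\<close>
    have "comp b 1 \<in> ?T" if b: "b \<in> B" for b
    proof -
      obtain l where l: "l < length bs" "bs ! l = b" using b bs in_set_conv_nth[of b bs] by auto
      then have "comp b 1 = x (n + 1 + l)" by (simp add: x_def y_def)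
      then show ?thesis using l by (auto intro!: real_vector.span_base)
    qed
    moreover have "real_vector.subspace {b. comp b 1 \<in> ?T}"
      by (rule real_vector.subspaceI)
        (auto simp: comp_add comp_scale intro: real_vector.span_zero real_vector.span_add real_vector.span_scale)
    ultimately have "real_vector.span B \<subseteq> {b. comp b 1 \<in> ?T}"
      by (intro real_vector.span_minimal) auto
    then have T: "comp a 1 \<in> ?T" for a using B(2) by blast
    show "A 1 \<subseteq> ?T"
    proof
      fix a assume "a \<in> A 1"
      then show "a \<in> ?T" using T[of a] comp_component[of a 1 1] by simp
    qed
  next
    fix k assume k: "k < n"
    have "(\<Sum>i\<in>?I. real i ^ k *\<^sub>R x i) =
        - (\<Sum>i\<in>?I. \<Sum>j=n+1..?m. (real i ^ k * (?d i \<bullet> moment_vec n j)) *\<^sub>R y j)"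
      by (simp add: x_def scaleR_sum_right sum_negf)
    also have "\<dots> = - (\<Sum>j=n+1..?m. (\<Sum>i\<in>?I. real i ^ k * (?d i \<bullet> moment_vec n j)) *\<^sub>R y j)"
      by (subst sum.swap) (simp add: scaleR_sum_left)
    also have "\<dots> = - (\<Sum>j=n+1..?m. real j ^ k *\<^sub>R y j)"
      using k by (simp only: moment_vec_expansion[OF finite_atLeastAtMost _ k] card_atLeastAtMost diff_Suc_1)
    also have "(\<Sum>j=n+1..?m. real j ^ k *\<^sub>R y j) = (\<Sum>j=n+1..?m. real j ^ k *\<^sub>R x j)"
      by (intro sum.cong refl) (simp add: x_def)
    finally have "(\<Sum>i\<in>?I. real i ^ k *\<^sub>R x i) + (\<Sum>j=n+1..?m. real j ^ k *\<^sub>R x j) = 0" by simp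
    moreover have "{1..?m} = ?I \<union> {n+1..?m}" by auto
    ultimately show "(\<Sum>j=1..?m. real j ^ k *\<^sub>R x j) = 0"
      by (simp add: sum.union_disjoint)
  qed
qed

theorem theorem10p1:
  fixes n :: nat
    and A :: "nat \<Rightarrow> 'a::{comm_ring_1,real_algebra_1} set"
    and intg :: "'a \<Rightarrow> real"
  assumes "n \<ge> 1"
    and "poincare_duality_algebra n A intg"
    and "generated_in_degree_two A"
  shows "\<exists>(m :: nat) (w :: nat set \<Rightarrow> real) (lam :: nat \<Rightarrow> real vec).
           complete_multi_fan n m w lam \<and>
           graded_isomorphic_to_multi_fan_algebra A n m w lam"
proof -
  interpret poincare_duality_algebra n A intg by fact
  obtain m and x :: "nat \<Rightarrow> 'a" where "n \<le> m" "\<And>i. x i \<in> A 1"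
    "A 1 \<subseteq> real_vector.span (x ` {1..m})"
    "\<And>k. k < n \<Longrightarrow> (\<Sum>j=1..m. real j ^ k *\<^sub>R x j) = 0"
    using exists_related_spanning_family[OF assms(1)] by blast
  then interpret generated_poincare_duality_algebra n A intg m x
    using assms by unfold_locales auto
  show ?thesis using complete_multi_fan_weight graded_isomorphic by blast
qed

end
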